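(* Let $p\in(0,\infty]$, $q\in[1,\infty]$ and let $b$ be a slowly varying function. Then $\lVert\cdot\rVert_{(p,q,b)}$ is a rearrangement-invariant Banach function norm on $M(R,\mu)$ (and consequently $L^{(p,q,b)}$ is a rearrangement-invariant Banach function space) if and only if one of the following conditions holds: (i) $p\in(1,\infty)$; (ii) $p=1$ and $\lVert t^{-1/q}b(t)\chi_{(1,\infty)}(t)\rVert_q<\infty$; (iii) $p=\infty$ and $\lVert t^{-1/q}b(t)\chi_{(0,1)}(t)\rVert_q<\infty$. Furthermore, if none of these conditions is satisfied, then $L^{(p,q,b)}=\{0\}$.
   Context: $(R,\mu)$ is a $\sigma$-finite non-atomic measure space with $\mu(R)=\infty$; $M=M(R,\mu)$ is the set of extended complex-valued $\mu$-measurable functions on $R$ (identified when equal $\mu$-a.e.), $M_+$ its non-negative elements. For $f\in M$, $f^*(t)=\inf\{s\ge 0:\mu(\{|f|>s\})\le t\}$ and $f^{**}(t)=\frac1t\int_0^t f^*(s)\,ds$. Convention: $1/\infty=0$. A measurable $b:(0,\infty)\to(0,\infty)$ is slowly varying if for every $\varepsilon>0$ there are a non-decreasing function $b_\varepsilon$ and a non-increasing function $b_{-\varepsilon}$ with $t^\varepsilon b(t)\approx b_\varepsilon(t)$ and $t^{-\varepsilon}b(t)\approx b_{-\varepsilon}(t)$ on $(0,\infty)$, where $\approx$ denotes two-sided estimate up to positive finite multiplicative constants. For $f\in M$, $\lVert f\rVert_{(p,q,b)}=\lVert t^{1/p-1/q}b(t)f^{**}(t)\rVert_q$, where $\lVert\cdot\rVert_q$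 is the Lebesgue $L^q$ norm over $(0,\infty)$ with Lebesgue measure (in the variable $t$), and $L^{(p,q,b)}=\{f\in M:\lVert f\rVert_{(p,q,b)}<\infty\}$. A functional $\lVert\cdot\rVert:M\to[0,\infty]$ with $\lVert f\rVert=\lVert\,|f|\,\rVert$ is a rearrangement-invariant Banach function norm if on $M_+$: (P1) it is positively homogeneous, subadditive, and $\lVert f\rVert=0\iff f=0$ a.e.; (P2) $f\le g$ a.e. implies $\lVert f\rVert\le\lVert g\rVert$; (P3) $f_n\uparrow f$ a.e. implies $\lVert f_n\rVert\uparrow\lVert f\rVert$; (P4) $\lVert\chi_E\rVert<\infty$ whenever $\mu(E)<\infty$; (P5) for each $E$ with $\mu(E)<\infty$ there is $C_E<\infty$ with $\int_E f\,d\mu\le C_E\lVert f\rVert$ for all $f\in M_+$; (P6) $f^*=g^*$ implies $\lVert f\rVert=\lVert g\rVert$. The corresponding space $\{f:\lVert f\rVert<\infty\}$ is called a rearrangement-invariant Banach function space. *)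

theory Defs
  imports "HOL-Analysis.Analysis" "HOL-Probability.Essential_Supremum"
begin

section \<open>Extended complex numbers and measurable functions\<close>

text \<open>Extended complex values are those of the one-point compactification of the plane;
  \<open>None\<close> is the point at infinity.\<close>

type_synonym ecomplex = "complex option"

definition ecomplex_borel :: "ecomplex measure" where
  "ecomplex_borel = sigma UNIV {U. openin (Alexandroff_compactification euclidean) U}"

definition ecmod :: "ecomplex \<Rightarrow> ennreal" where
  "ecmod z = (case z of None \<Rightarrow> \<infinity> | Some w \<Rightarrow> ennreal (cmod w))"

definition ecomplex_of_ennreal :: "ennreal \<Rightarrow> ecomplex" where
  "ecomplex_of_ennreal r = (if r = \<infinity> then None else Some (complex_of_real (enn2real r)))"

text \<open>Elements of \<open>M(R,\<mu>)\<close> are represented by functions; identification of functions that agree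
  almost everywhere is expressed by \<open>AE\<close>.  Elements of \<open>M\<^sub>+\<close> are represented
  by measurable \<open>f :: 'a \<Rightarrow> ennreal\<close>, which \<open>emb f\<close> includes into \<open>M(R,\<mu>)\<close>.\<close>

definition meas_fun :: "'a measure \<Rightarrow> ('a \<Rightarrow> ecomplex) set" where
  "meas_fun M = measurable M ecomplex_borel"

definition emb :: "('a \<Rightarrow> ennreal) \<Rightarrow> 'a \<Rightarrow> ecomplex" where
  "emb f = (\<lambda>x. ecomplex_of_ennreal (f x))"

definition non_atomic :: "'a measure \<Rightarrow> bool" where
  "non_atomic M \<longleftrightarrow>
     (\<forall>A\<in>sets M. 0 < emeasure M A \<longrightarrow>
        (\<exists>B\<in>sets M. B \<subseteq> A \<and> 0 < emeasure M B \<and> emeasure M B < emeasure M A))"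

section \<open>Rearrangements\<close>

text \<open>The infimum of the empty set is \<open>\<infinity>\<close>.\<close>

definition rearr :: "'a measure \<Rightarrow> ('a \<Rightarrow> ecomplex) \<Rightarrow> real \<Rightarrow> ennreal" where
  "rearr M f t =
     Inf {ennreal s | s. 0 \<le> s \<and> emeasure M {x \<in> space M. ecmod (f x) > ennreal s} \<le> ennreal t}"

definition max_rearr :: "'a measure \<Rightarrow> ('a \<Rightarrow> ecomplex) \<Rightarrow> real \<Rightarrow> ennreal" where
  "max_rearr M f t = (\<integral>\<^sup>+ s \<in> {0<..<t}. rearr M f s \<partial>lebesgue) / ennreal t"

section \<open>Slowly varying functions\<close>

definition approx_pos :: "(real \<Rightarrow> real) \<Rightarrow> (real \<Rightarrow> real) \<Rightarrow> bool" where
  "approx_pos g h \<longleftrightarrow>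
     (\<exists>c C. 0 < c \<and> 0 < C \<and> (\<forall>t>0. c * h t \<le> g t \<and> g t \<le> C * h t))"

definition slowly_varying :: "(real \<Rightarrow> real) \<Rightarrow> bool" where
  "slowly_varying b \<longleftrightarrow>
     b \<in> borel_measurable (lebesgue_on {0<..}) \<and> (\<forall>t>0. 0 < b t) \<and>
     (\<forall>\<epsilon>>0.
        (\<exists>h. mono_on {0<..} h \<and> approx_pos (\<lambda>t. t powr \<epsilon> * b t) h) \<and>
        (\<exists>h. antimono_on {0<..} h \<and> approx_pos (\<lambda>t. t powr (- \<epsilon>) * b t) h))"

section \<open>The Lorentz--Karamata functional\<close>

text \<open>Power of an extended non-negative number; only used with exponents \<open>a > 0\<close>.\<close>

definition ennpowr :: "ennreal \<Rightarrow> real \<Rightarrow> ennreal" where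
  "ennpowr x a = (if x = \<infinity> then \<infinity> else ennreal (enn2real x powr a))"

definition Lq_norm :: "ennreal \<Rightarrow> (real \<Rightarrow> ennreal) \<Rightarrow> ennreal" where
  "Lq_norm q g =
     (if q = \<infinity> then esssup (lebesgue_on {0<..}) g
      else ennpowr (\<integral>\<^sup>+ t. ennpowr (g t) (enn2real q) \<partial>lebesgue_on {0<..}) (1 / enn2real q))"

text \<open>\<open>recip p\<close> is \<open>1/p\<close> as a real number for \<open>p \<in> (0,\<infinity>]\<close>; in particular \<open>recip \<infinity> = 0\<close>.\<close>

definition recip :: "ennreal \<Rightarrow> real" where
  "recip p = enn2real (1 / p)"

definition LK_norm ::
    "'a measure \<Rightarrow> ennreal \<Rightarrow> ennreal \<Rightarrow> (real \<Rightarrow> real) \<Rightarrow> ('a \<Rightarrow> ecomplex) \<Rightarrow> ennreal" where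
  "LK_norm M p q b f =
     Lq_norm q (\<lambda>t. ennreal (t powr (recip p - recip q) * b t) * max_rearr M f t)"

definition LK_space ::
    "'a measure \<Rightarrow> ennreal \<Rightarrow> ennreal \<Rightarrow> (real \<Rightarrow> real) \<Rightarrow> ('a \<Rightarrow> ecomplex) set" where
  "LK_space M p q b = {f \<in> meas_fun M. LK_norm M p q b f < \<infinity>}"

section \<open>Rearrangement-invariant Banach function norms and spaces\<close>

text \<open>The conjuncts after the first are (P1) (in three parts) and (P2)--(P6).\<close>

definition ri_Banach_function_norm ::
    "'a measure \<Rightarrow> (('a \<Rightarrow> ecomplex) \<Rightarrow> ennreal) \<Rightarrow> bool" where
  "ri_Banach_function_norm M N \<longleftrightarrow>
     (\<forall>f\<in>meas_fun M. N f = N (emb (\<lambda>x. ecmod (f x)))) \<and>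
     (\<forall>f\<in>borel_measurable M. \<forall>a::real. 0 \<le> a \<longrightarrow>
        N (emb (\<lambda>x. ennreal a * f x)) = ennreal a * N (emb f)) \<and>
     (\<forall>f\<in>borel_measurable M. \<forall>g\<in>borel_measurable M.
        N (emb (\<lambda>x. f x + g x)) \<le> N (emb f) + N (emb g)) \<and>
     (\<forall>f\<in>borel_measurable M. N (emb f) = 0 \<longleftrightarrow> (AE x in M. f x = 0)) \<and>
     (\<forall>f\<in>borel_measurable M. \<forall>g\<in>borel_measurable M.
        (AE x in M. f x \<le> g x) \<longrightarrow> N (emb f) \<le> N (emb g)) \<and>
     (\<forall>F f. (\<forall>n::nat. F n \<in> borel_measurable M) \<longrightarrow> f \<in> borel_measurable M \<longrightarrow>
        (AE x in M. incseq (\<lambda>n. F n x) \<and> f x = (SUP n. F n x)) \<longrightarrow>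
        incseq (\<lambda>n. N (emb (F n))) \<and> N (emb f) = (SUP n. N (emb (F n)))) \<and>
     (\<forall>E\<in>sets M. emeasure M E < \<infinity> \<longrightarrow> N (emb (indicator E)) < \<infinity>) \<and>
     (\<forall>E\<in>sets M. emeasure M E < \<infinity> \<longrightarrow>
        (\<exists>C<\<infinity>. \<forall>f\<in>borel_measurable M. (\<integral>\<^sup>+ x \<in> E. f x \<partial>M) \<le> C * N (emb f))) \<and>
     (\<forall>f\<in>borel_measurable M. \<forall>g\<in>borel_measurable M.
        (\<forall>t\<ge>0. rearr M (emb f) t = rearr M (emb g) t) \<longrightarrow> N (emb f) = N (emb g))"

definition ri_Banach_function_space :: "'a measure \<Rightarrow> ('a \<Rightarrow> ecomplex) set \<Rightarrow> bool" where
  "ri_Banach_function_space M X \<longleftrightarrow>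
     (\<exists>N. ri_Banach_function_norm M N \<and> X = {f \<in> meas_fun M. N f < \<infinity>})"

end

theory Submission
  imports Defs
begin

text \<open>
  The integral of \<open>f\<^sup>*\<close> over \<open>(0,t)\<close> is \<open>\<integral>\<^sub>0\<^sup>\<infinity> min t (d y) dy\<close>, where \<open>d\<close> is the distribution function
  of \<open>|f|\<close>. Monotone convergence is immediate in this form, and by the layer-cake formula it equals
  the minimum of \<open>l t + \<integral> max 0 (|f| - l) d\<mu>\<close> over \<open>l \<ge> 0\<close>, which gives the subadditivity of \<open>f\<^sup>*\<^sup>*\<close>.
  Finally, if \<open>f\<close> is a non-zero function, then \<open>f\<^sup>*\<^sup>*(t)\<close> is at least a positive multiple of
  \<open>min 1 (1/t)\<close>, with a matching upper bound for characteristic functions of sets of finite measure.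
  So everything is decided by the finiteness of the \<open>L\<^sup>q\<close> norms of \<open>t\<^bsup>1/p-1/q\<^esup> b(t)\<close> on \<open>(0,1)\<close> and of
  \<open>t\<^bsup>1/p-1-1/q\<^esup> b(t)\<close> on \<open>(1,\<infinity>)\<close>, and slow variation settles all cases except \<open>1/p = 0\<close>
  for the former and \<open>1/p = 1\<close> for the latter.
\<close>

section \<open>The integral of the rearrangement\<close>

lemma ecmod_emb [simp]: "ecmod (emb g x) = g x"
  by (cases "g x") (auto simp: emb_def ecomplex_of_ennreal_def ecmod_def)

text \<open>The set where the modulus exceeds a finite level is the complement of a closed ball
  together with \<open>None\<close>. Closed balls are compact, so this set is open in the one-point
  compactification.\<close>

lemma borel_measurable_ecmod:
  assumes "f \<in> meas_fun M"
  shows "(\<lambda>x. ecmod (f x)) \<in> borel_measurable M"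
proof -
  have "ecmod \<in> borel_measurable ecomplex_borel"
  proof (rule borel_measurableI_greater)
    fix y :: ennreal
    show "{x \<in> space ecomplex_borel. y < ecmod x} \<in> sets ecomplex_borel"
    proof (cases y)
      case (real r)
      have "{x. y < ecmod x} = insert None (Some ` (UNIV - cball 0 r))"
      proof (rule set_eqI)
        fix z :: ecomplex
        show "z \<in> {x. y < ecmod x} \<longleftrightarrow> z \<in> insert None (Some ` (UNIV - cball 0 r))"
          using real by (cases z) (auto simp: ecmod_def ennreal_less_iff)
      qed
      moreover have "openin (Alexandroff_compactification euclidean) (insert None (Some ` (UNIV - cball (0::complex) r)))"
        unfolding openin_Alexandroff_compactification
        by (intro disjI2 exI[of _ "cball 0 r"]) auto
      ultimately show ?thesis
        by (auto simp: ecomplex_borel_def space_measure_of_conv)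
    qed auto
  qed
  then show ?thesis
    using assms unfolding meas_fun_def by (rule measurable_compose_rev)
qed

section \<open>Distribution functions and their inversion\<close>

definition distr_fun :: "'a measure \<Rightarrow> ('a \<Rightarrow> ennreal) \<Rightarrow> real \<Rightarrow> ennreal" where
  "distr_fun M u y = emeasure M {x \<in> space M. ennreal y < u x}"

text \<open>The K-functional of \<open>u\<close> between \<open>L\<^sup>1\<close> and \<open>L\<^sup>\<infinity>\<close>.\<close>

definition K_fun :: "'a measure \<Rightarrow> ('a \<Rightarrow> ennreal) \<Rightarrow> real \<Rightarrow> ennreal" where
  "K_fun M u t = (\<integral>\<^sup>+ y \<in> {0<..}. min (ennreal t) (distr_fun M u y) \<partial>lborel)"

lemma ennreal_eq_topI:
  assumes "\<And>r. 0 \<le> r \<Longrightarrow> ennreal r \<le> x"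
  shows "x = top"
proof (cases x)
  case (real r)
  then show ?thesis using assms[of "r + 1"] by simp
qed

text \<open>Presents a truncated difference, possibly infinite, as the length of a set of reals.
  With it Tonelli's theorem applies to extended values and to their real levels at once.\<close>

lemma emeasure_lborel_ennreal_between:
  assumes "0 \<le> l"
  shows "emeasure lborel {y. l < y \<and> ennreal y < c} = c - ennreal l"
proof (cases c)
  case (real r)
  have "{y. l < y \<and> ennreal y < c} = {l<..<r}"
    using real assms by (auto simp: ennreal_less_iff)
  then have "emeasure lborel {y. l < y \<and> ennreal y < c} = emeasure lborel {l<..<r}"
    by simp
  also have "\<dots> = c - ennreal l"
    using real assms by (cases "l \<le> r") (auto simp: ennreal_minus ennreal_neg)
  finally show ?thesis .
next
  case top
  have "ennreal n \<le> emeasure lborel {l<..}" if "0 \<le> n" for n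
  proof -
    have "ennreal n = emeasure lborel {l<..<l+n}" using that by simp
    also have "\<dots> \<le> emeasure lborel {l<..}" by (rule emeasure_mono) auto
    finally show ?thesis .
  qed
  then have "emeasure lborel {l<..} = top"
    by (rule ennreal_eq_topI)
  moreover have "{y. l < y \<and> ennreal y < c} = {l<..}" using top by auto
  ultimately show ?thesis using top by (simp add: ennreal_top_minus)
qed

lemma distr_fun_antimono:
  assumes "u \<in> borel_measurable M" "y \<le> z"
  shows "distr_fun M u z \<le> distr_fun M u y"
  unfolding distr_fun_def using assms
  by (intro emeasure_mono) (auto intro: le_less_trans ennreal_leI)

text \<open>The rearrangement and the distribution function are generalized inverses of each other.
  From left to right this is the definition of the infimum; the converse rests on right-continuity
  of the distribution function.\<close>

lemma rearr_greater_iff: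
  assumes u[measurable]: "(\<lambda>x. ecmod (f x)) \<in> borel_measurable M" and y: "0 \<le> y"
  shows "ennreal y < rearr M f s \<longleftrightarrow> ennreal s < distr_fun M (\<lambda>x. ecmod (f x)) y"
proof
  let ?d = "distr_fun M (\<lambda>x. ecmod (f x))"
  assume "ennreal y < rearr M f s"
  then show "ennreal s < ?d y"
    using y unfolding rearr_def distr_fun_def
    by (metis (mono_tags, lifting) Inf_lower mem_Collect_eq linorder_not_le)
next
  let ?d = "distr_fun M (\<lambda>x. ecmod (f x))"
  assume less: "ennreal s < ?d y"
  \<comment> \<open>The superlevel sets at \<open>y + 1 / Suc n\<close> increase to the one at
    \<open>y\<close>, so by continuity from below one of them already has measure above
    \<open>s\<close>; its level then bounds the infimum from below, strictly above
    \<open>y\<close>.\<close>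
  define A where "A n = {x \<in> space M. ennreal (y + 1 / Suc n) < ecmod (f x)}" for n
  have "(SUP n. emeasure M (A n)) = emeasure M (\<Union>n. A n)"
  proof (rule SUP_emeasure_incseq)
    show "range A \<subseteq> sets M" unfolding A_def by auto
    show "incseq A"
    proof (rule incseq_SucI)
      fix n
      have "ennreal (y + 1 / Suc (Suc n)) \<le> ennreal (y + 1 / Suc n)"
        by (intro ennreal_leI) (auto simp: field_simps)
      then show "A n \<subseteq> A (Suc n)"
        unfolding A_def by (auto intro: le_less_trans)
    qed
  qed
  also have "(\<Union>n. A n) = {x \<in> space M. ennreal y < ecmod (f x)}"
  proof (intro set_eqI iffI)
    fix x assume "x \<in> (\<Union>n. A n)"
    then obtain n where "x \<in> space M" "ennreal (y + 1 / Suc n) < ecmod (f x)" by (auto simp: A_def)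
    moreover have "ennreal y \<le> ennreal (y + 1 / Suc n)" by (intro ennreal_leI) auto
    ultimately show "x \<in> {x \<in> space M. ennreal y < ecmod (f x)}" by auto
  next
    fix x assume x: "x \<in> {x \<in> space M. ennreal y < ecmod (f x)}"
    then obtain z where z: "ennreal y < z" "z < ecmod (f x)" using dense by blast
    then obtain r where r: "z = ennreal r" "0 \<le> r" by (cases z) auto
    have "y < r" using z r y by (simp add: ennreal_less_iff)
    then obtain n where "inverse (real (Suc n)) < r - y" using reals_Archimedean[of "r - y"] by auto
    then have "ennreal (y + 1 / Suc n) \<le> z" unfolding r by (intro ennreal_leI) (auto simp: field_simps)
    then show "x \<in> (\<Union>n. A n)" using z x by (auto simp: A_def intro: le_less_trans)
  qed
  finally have "ennreal s < (SUP n. emeasure M (A n))"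
    using less unfolding distr_fun_def by simp
  then obtain n where n: "ennreal s < ?d (y + 1 / Suc n)"
    unfolding less_SUP_iff A_def distr_fun_def by auto
  have "ennreal (y + 1 / Suc n) \<le> rearr M f s"
    unfolding rearr_def
  proof (rule Inf_greatest, safe)
    fix z :: real assume z: "0 \<le> z" "emeasure M {x \<in> space M. ennreal z < ecmod (f x)} \<le> ennreal s"
    then have "?d z < ?d (y + 1 / Suc n)" using n by (auto simp: distr_fun_def)
    then have "y + 1 / Suc n \<le> z"
      using distr_fun_antimono[OF u, of z "y + 1 / Suc n"] by force
    then show "ennreal (y + 1 / Suc n) \<le> ennreal z" by (rule ennreal_leI)
  qed
  moreover have "ennreal y < ennreal (y + 1 / Suc n)" using y by (simp add: ennreal_less_iff)
  ultimately show "ennreal y < rearr M f s" by (rule less_le_trans[rotated])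
qed

text \<open>The value at \<open>y\<close> is the measure of a section of a jointly measurable set,
  hence measurable in \<open>y\<close> by sigma-finiteness.\<close>

lemma distr_fun_borel_measurable [measurable]:
  assumes "sigma_finite_measure M" and u[measurable]: "u \<in> borel_measurable M"
  shows "distr_fun M u \<in> borel_measurable borel"
proof -
  interpret sigma_finite_measure M by fact
  have *: "distr_fun M u y = (\<integral>\<^sup>+ x. indicator {x. ennreal y < u x} x \<partial>M)" for y
    unfolding distr_fun_def
    by (subst nn_integral_indicator[symmetric])
       (auto intro!: nn_integral_cong simp: indicator_def simp del: nn_integral_indicator)
  have "(\<lambda>y. \<integral>\<^sup>+ x. indicator {x. ennreal y < u x} x \<partial>M) \<in> borel_measurable borel"
    unfolding indicator_def mem_Collect_eq by measurable
  then show ?thesis unfolding * [symmetric] by simp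
qed

lemma K_fun_borel_measurable:
  assumes "sigma_finite_measure M" "u \<in> borel_measurable M"
  shows "K_fun M u \<in> borel_measurable borel"
proof -
  note [measurable] = distr_fun_borel_measurable[OF assms]
  show ?thesis unfolding K_fun_def[abs_def] by measurable
qed

section \<open>Tonelli formulas\<close>

text \<open>Write the rearrangement at \<open>s\<close> as the length of the set of levels
  \<open>y\<close> below it. By \<open>rearr_greater_iff\<close> these are the \<open>y\<close> with
  \<open>s\<close> below the distribution function at \<open>y\<close>, so after exchanging the
  integrals the inner one is a minimum.\<close>

lemma nn_integral_rearr:
  assumes M: "sigma_finite_measure M" and u: "(\<lambda>x. ecmod (f x)) \<in> borel_measurable M"
  shows "(\<integral>\<^sup>+ s \<in> {0<..<t}. rearr M f s \<partial>lebesgue) = K_fun M (\<lambda>x. ecmod (f x)) t"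
proof -
  let ?d = "distr_fun M (\<lambda>x. ecmod (f x))"
  note [measurable] = distr_fun_borel_measurable[OF M u]
  have *: "rearr M f s * indicator {0<..<t} s =
    (\<integral>\<^sup>+ y. indicator {0<..} y * indicator {0<..<t} s * indicator {s. ennreal s < ?d y} s \<partial>lborel)" for s
  proof -
    have "rearr M f s = emeasure lborel {y. 0 < y \<and> ennreal y < rearr M f s}"
      by (simp add: emeasure_lborel_ennreal_between)
    also have "\<dots> = (\<integral>\<^sup>+ y. indicator {y. 0 < y \<and> ennreal y < rearr M f s} y \<partial>lborel)"
      by simp
    also have "\<dots> = (\<integral>\<^sup>+ y. indicator {0<..} y * indicator {s. ennreal s < ?d y} s \<partial>lborel)"
      using rearr_greater_iff[OF u] by (intro nn_integral_cong) (auto simp: indicator_def)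
    finally show ?thesis
      by (simp add: indicator_def mult.commute mult.left_commute)
  qed
  have meas: "(\<lambda>(s, y). indicator {0<..} y * indicator {0<..<t} s * indicator {s. ennreal s < ?d y} s)
      \<in> borel_measurable (lborel \<Otimes>\<^sub>M lborel :: (real \<times> real) measure)" for t
    unfolding indicator_def mem_Collect_eq by measurable
  \<comment> \<open>The integrand is the indicator of the points between 0 and the minimum of
    \<open>t\<close> and \<open>c\<close>.\<close>
  have min: "(\<integral>\<^sup>+ s. indicator {0<..<t} s * indicator {s. ennreal s < c} s \<partial>lborel) = min (ennreal t) c" for c
  proof -
    have "(\<integral>\<^sup>+ s. indicator {0<..<t} s * indicator {s. ennreal s < c} s \<partial>lborel)
       = (\<integral>\<^sup>+ s. indicator {s. 0 < s \<and> ennreal s < min (ennreal t) c} s \<partial>lborel)"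
      by (intro nn_integral_cong) (auto simp: indicator_def ennreal_less_iff)
    also have "\<dots> = emeasure lborel {s. 0 < s \<and> ennreal s < min (ennreal t) c}"
      by (rule nn_integral_indicator) measurable
    also have "\<dots> = min (ennreal t) c"
      by (simp only: emeasure_lborel_ennreal_between) simp
    finally show ?thesis .
  qed
  have "(\<integral>\<^sup>+ s \<in> {0<..<t}. rearr M f s \<partial>lebesgue) = (\<integral>\<^sup>+ s. (\<integral>\<^sup>+ y. indicator {0<..} y * indicator {0<..<t} s * indicator {s. ennreal s < ?d y} s \<partial>lborel) \<partial>lborel)"
    unfolding * by (rule nn_integral_completion)
  also have "\<dots> = (\<integral>\<^sup>+ y. (\<integral>\<^sup>+ s. indicator {0<..} y * indicator {0<..<t} s * indicator {s. ennreal s < ?d y} s \<partial>lborel) \<partial>lborel)"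
    by (rule lborel_pair.Fubini'[symmetric]) (rule meas)
  also have "\<dots> = (\<integral>\<^sup>+ y. indicator {0<..} y * min (ennreal t) (?d y) \<partial>lborel)"
    by (intro nn_integral_cong) (simp add: mult.assoc nn_integral_cmult min)
  finally show ?thesis by (simp add: K_fun_def mult.commute)
qed

text \<open>Tonelli's theorem for the region between the level \<open>l\<close> and the graph of
  \<open>u\<close>. Subtraction in \<open>ennreal\<close> is truncated, so the left-hand integrand
  is the positive part of the difference.\<close>

lemma nn_integral_layer_cake:
  assumes M: "sigma_finite_measure M" and u[measurable]: "u \<in> borel_measurable M" and l: "0 \<le> l"
  shows "(\<integral>\<^sup>+ x. u x - ennreal l \<partial>M) = (\<integral>\<^sup>+ y \<in> {l<..}. distr_fun M u y \<partial>lborel)"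
proof -
  interpret pair_sigma_finite M lborel
    by (intro pair_sigma_finite.intro M lborel.sigma_finite_measure_axioms)
  have "(\<integral>\<^sup>+ x. u x - ennreal l \<partial>M) = (\<integral>\<^sup>+ x. (\<integral>\<^sup>+ y. indicator {l<..} y * indicator {x. ennreal y < u x} x \<partial>lborel) \<partial>M)"
    using l by (intro nn_integral_cong, subst emeasure_lborel_ennreal_between[symmetric], simp,
      subst nn_integral_indicator[symmetric])
      (auto intro!: nn_integral_cong simp: indicator_def simp del: nn_integral_indicator)
  also have "\<dots> = (\<integral>\<^sup>+ y. (\<integral>\<^sup>+ x. indicator {l<..} y * indicator {x. ennreal y < u x} x \<partial>M) \<partial>lborel)"
    by (rule Fubini'[symmetric]) (unfold indicator_def mem_Collect_eq, measurable)
  also have "\<dots> = (\<integral>\<^sup>+ y. distr_fun M u y * indicator {l<..} y \<partial>lborel)"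
  proof (intro nn_integral_cong)
    fix y :: real
    have "(\<integral>\<^sup>+ x. indicator {x. ennreal y < u x} x \<partial>M) = (\<integral>\<^sup>+ x. indicator {x\<in>space M. ennreal y < u x} x \<partial>M)"
      by (intro nn_integral_cong) (auto simp: indicator_def)
    also have "\<dots> = distr_fun M u y" unfolding distr_fun_def by simp
    finally have "(\<integral>\<^sup>+ x. indicator {x. ennreal y < u x} x \<partial>M) = distr_fun M u y" .
    then show "(\<integral>\<^sup>+ x. indicator {l<..} y * indicator {x. ennreal y < u x} x \<partial>M) = distr_fun M u y * indicator {l<..} y"
      by (cases "l < y") (auto simp: indicator_def)
  qed
  finally show ?thesis .
qed

lemma nn_integral_split_at:
  assumes "0 \<le> (l::real)" "g \<in> borel_measurable borel"
  shows "(\<integral>\<^sup>+ y \<in> {0<..}. g y \<partial>lborel) = (\<integral>\<^sup>+ y \<in> {0<..l}. g y \<partial>lborel) + (\<integral>\<^sup>+ y \<in> {l<..}. g y \<partial>lborel)"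
  using assms by (subst nn_integral_add[symmetric]) (auto intro!: nn_integral_cong simp: indicator_def)

section \<open>The variational formula and subadditivity\<close>

text \<open>Bound the minimum by \<open>t\<close> on levels up to \<open>l\<close> and by the
  distribution function above \<open>l\<close>, where the layer-cake formula evaluates the
  integral.\<close>

lemma K_fun_le:
  assumes M: "sigma_finite_measure M" and u: "u \<in> borel_measurable M" and l: "0 \<le> l"
  shows "K_fun M u t \<le> ennreal l * ennreal t + (\<integral>\<^sup>+ x. u x - ennreal l \<partial>M)"
proof -
  note [measurable] = distr_fun_borel_measurable[OF M u]
  have "K_fun M u t = (\<integral>\<^sup>+ y \<in> {0<..l}. min (ennreal t) (distr_fun M u y) \<partial>lborel)
      + (\<integral>\<^sup>+ y \<in> {l<..}. min (ennreal t) (distr_fun M u y) \<partial>lborel)"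
    unfolding K_fun_def by (rule nn_integral_split_at) (use l in auto)
  also have "\<dots> \<le> (\<integral>\<^sup>+ y. ennreal t * indicator {0<..l} y \<partial>lborel) + (\<integral>\<^sup>+ y \<in> {l<..}. distr_fun M u y \<partial>lborel)"
    by (intro add_mono nn_integral_mono) (auto simp: indicator_def)
  finally show ?thesis
    using l by (simp add: nn_integral_layer_cake[OF M u l] nn_integral_cmult_indicator mult.commute)
qed

text \<open>Equality in \<open>K_fun_le\<close> holds for \<open>l = u\<^sup>*(t)\<close>.\<close>

lemma K_fun_attained:
  assumes M: "sigma_finite_measure M" and u: "u \<in> borel_measurable M" and t: "0 < t"
    and fin: "K_fun M u t < \<infinity>"
  obtains l where "0 \<le> l" "K_fun M u t = ennreal l * ennreal t + (\<integral>\<^sup>+ x. u x - ennreal l \<partial>M)"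
proof -
  note [measurable] = distr_fun_borel_measurable[OF M u]
  define L where "L = rearr M (emb u) t"
  have iff: "ennreal y < L \<longleftrightarrow> ennreal t < distr_fun M u y" if "0 \<le> y" for y
    unfolding L_def using rearr_greater_iff[of "emb u" M y t] u that by simp
  \<comment> \<open>An infinite \<open>L\<close> would make the integrand equal to \<open>t\<close>
    at every positive level, contradicting the finiteness of the integral.\<close>
  have "L \<noteq> \<infinity>"
  proof
    assume "L = \<infinity>"
    then have "min (ennreal t) (distr_fun M u y) = ennreal t" if "0 < y" for y
      using iff[of y] that by (auto simp: min_def)
    then have "K_fun M u t = (\<integral>\<^sup>+ y. ennreal t * indicator {y. 0 < y \<and> ennreal y < top} y \<partial>lborel)"
      unfolding K_fun_def by (intro nn_integral_cong) (auto simp: indicator_def)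
    also have "\<dots> = ennreal t * (\<integral>\<^sup>+ y. indicator {y. 0 < y \<and> ennreal y < top} y \<partial>lborel)"
      by (rule nn_integral_cmult) auto
    also have "\<dots> = \<infinity>"
      using t emeasure_lborel_ennreal_between[of 0 top] by (simp add: ennreal_mult_top)
    finally show False using fin by simp
  qed
  then obtain l where l: "L = ennreal l" "0 \<le> l" by (cases L) auto
  have lo: "min (ennreal t) (distr_fun M u y) = ennreal t" if "0 < y" "y < l" for y
    using iff[of y] that l by (auto simp: ennreal_less_iff min_def)
  have hi: "min (ennreal t) (distr_fun M u y) = distr_fun M u y" if "l \<le> y" for y
    using iff[of y] that l by (auto simp: ennreal_less_iff min_def not_less)
  have "K_fun M u t = (\<integral>\<^sup>+ y \<in> {0<..l}. min (ennreal t) (distr_fun M u y) \<partial>lborel)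
      + (\<integral>\<^sup>+ y \<in> {l<..}. min (ennreal t) (distr_fun M u y) \<partial>lborel)"
    unfolding K_fun_def by (rule nn_integral_split_at) (use l in auto)
  also have "(\<integral>\<^sup>+ y \<in> {l<..}. min (ennreal t) (distr_fun M u y) \<partial>lborel) = (\<integral>\<^sup>+ x. u x - ennreal l \<partial>M)"
    unfolding nn_integral_layer_cake[OF M u l(2)]
    by (intro nn_integral_cong) (auto simp: indicator_def hi)
  also have "(\<integral>\<^sup>+ y \<in> {0<..l}. min (ennreal t) (distr_fun M u y) \<partial>lborel) = (\<integral>\<^sup>+ y. ennreal t * indicator {0<..l} y \<partial>lborel)"
  \<comment> \<open>At the endpoint \<open>y = l\<close> the distribution function may lie below
    \<open>t\<close>, so this single point is discarded as a null set.\<close>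
  proof (rule nn_integral_cong_AE)
    have "AE y in lborel. y \<noteq> l" by (rule AE_lborel_singleton)
    then show "AE y in lborel. min (ennreal t) (distr_fun M u y) * indicator {0<..l} y = ennreal t * indicator {0<..l} y"
      by eventually_elim (auto simp: indicator_def lo)
  qed
  also have "\<dots> = ennreal l * ennreal t" using l by (simp add: nn_integral_cmult_indicator mult.commute)
  finally show ?thesis using that l by blast
qed

text \<open>Let \<open>k\<close> and \<open>l\<close> be optimal levels for \<open>u\<close> and
  \<open>v\<close>. The level \<open>k + l\<close> is admissible for the sum, and the excess of
  \<open>u + v\<close> over \<open>k + l\<close> is at most the sum of the two excesses.\<close>

lemma K_fun_add_le:
  assumes M: "sigma_finite_measure M"
    and u: "u \<in> borel_measurable M" and v: "v \<in> borel_measurable M" and t: "0 < t"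
  shows "K_fun M (\<lambda>x. u x + v x) t \<le> K_fun M u t + K_fun M v t"
proof (cases "K_fun M u t < \<infinity> \<and> K_fun M v t < \<infinity>")
  case True
  note [measurable] = u v
  from True obtain k l where kl: "0 \<le> k" "0 \<le> l"
    "K_fun M u t = ennreal k * ennreal t + (\<integral>\<^sup>+ x. u x - ennreal k \<partial>M)"
    "K_fun M v t = ennreal l * ennreal t + (\<integral>\<^sup>+ x. v x - ennreal l \<partial>M)"
    using K_fun_attained[OF M u t] K_fun_attained[OF M v t] by metis
  have "K_fun M (\<lambda>x. u x + v x) t \<le> ennreal (k + l) * ennreal t + (\<integral>\<^sup>+ x. u x + v x - ennreal (k + l) \<partial>M)"
    using kl by (intro K_fun_le M) auto
  also have "(\<integral>\<^sup>+ x. u x + v x - ennreal (k + l) \<partial>M) \<le> (\<integral>\<^sup>+ x. (u x - ennreal k) + (v x - ennreal l) \<partial>M)"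
  proof (intro nn_integral_mono)
    fix x
    have "u x \<le> (u x - ennreal k) + ennreal k" "v x \<le> (v x - ennreal l) + ennreal l"
      by (metis add.commute ennreal_minus_le_iff order_refl ennreal_neq_top)+
    then have "u x + v x \<le> ennreal (k + l) + ((u x - ennreal k) + (v x - ennreal l))"
      using kl add_mono[of "u x" _ "v x"] by (fastforce simp: ac_simps)
    then show "u x + v x - ennreal (k + l) \<le> (u x - ennreal k) + (v x - ennreal l)"
      by (simp add: ennreal_minus_le_iff)
  qed
  also have "\<dots> = (\<integral>\<^sup>+ x. u x - ennreal k \<partial>M) + (\<integral>\<^sup>+ x. v x - ennreal l \<partial>M)"
    by (rule nn_integral_add) auto
  finally show ?thesis using kl by (simp add: distrib_left ac_simps)
qed (auto simp: not_less top_unique)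

section \<open>Monotonicity, monotone convergence and scaling\<close>

lemma distr_fun_mono_AE:
  assumes "v \<in> borel_measurable M" "AE x in M. u x \<le> v x"
  shows "distr_fun M u y \<le> distr_fun M v y"
  unfolding distr_fun_def
proof (rule emeasure_mono_AE)
  show "AE x in M. x \<in> {x \<in> space M. ennreal y < u x} \<longrightarrow> x \<in> {x \<in> space M. ennreal y < v x}"
    using assms(2) by eventually_elim auto
  show "{x \<in> space M. ennreal y < v x} \<in> sets M" using assms(1) by measurable
qed

lemma K_fun_mono_AE:
  assumes "v \<in> borel_measurable M" "AE x in M. u x \<le> v x"
  shows "K_fun M u t \<le> K_fun M v t"
  unfolding K_fun_def
  by (intro nn_integral_mono mult_right_mono min.mono order_refl distr_fun_mono_AE[OF assms]) auto

text \<open>Continuity from below of the measure, applied to the superlevel sets.\<close>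

lemma distr_fun_SUP:
  assumes F[measurable]: "\<And>n::nat. F n \<in> borel_measurable M" and u[measurable]: "u \<in> borel_measurable M"
    and ae: "AE x in M. incseq (\<lambda>n. F n x) \<and> u x = (SUP n. F n x)"
  shows "distr_fun M u y = (SUP n. distr_fun M (F n) y)"
proof -
  \<comment> \<open>The sequence increases only almost everywhere. Its running maxima increase at
    every point, stay measurable and agree with it almost everywhere.\<close>
  define G where "G n x = (SUP k\<in>{..n}. F k x)" for n x
  have G[measurable]: "G n \<in> borel_measurable M" for n unfolding G_def[abs_def] by measurable
  have GF: "AE x in M. G n x = F n x" for n
    using ae
  proof eventually_elim
    case (elim x)
    then show ?case unfolding G_def
      by (intro antisym SUP_least SUP_upper) (auto simp: incseq_def)
  qed
  have inc: "incseq (\<lambda>n. {x \<in> space M. ennreal y < G n x})"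
    unfolding incseq_def G_def by (auto intro: less_le_trans SUP_subset_mono)
  have "(SUP n. distr_fun M (F n) y) = (SUP n. emeasure M {x \<in> space M. ennreal y < G n x})"
  proof (intro SUP_cong refl)
    fix n
    show "distr_fun M (F n) y = emeasure M {x \<in> space M. ennreal y < G n x}"
      unfolding distr_fun_def by (rule emeasure_eq_AE) (use GF[of n] in auto)
  qed
  also have "\<dots> = emeasure M (\<Union>n. {x \<in> space M. ennreal y < G n x})"
    by (rule SUP_emeasure_incseq[OF _ inc]) auto
  also have "\<dots> = distr_fun M u y"
    unfolding distr_fun_def
  proof (rule emeasure_eq_AE)
    have "AE x in M. \<forall>n. G n x = F n x" using GF by (simp add: AE_all_countable)
    with ae show "AE x in M. x \<in> (\<Union>n. {x \<in> space M. ennreal y < G n x}) \<longleftrightarrow> x \<in> {x \<in> space M. ennreal y < u x}"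
      by eventually_elim (auto simp: less_SUP_iff)
  qed auto
  finally show ?thesis by simp
qed

text \<open>Minimum with a constant commutes with suprema, so monotone convergence in
  \<open>y\<close> finishes after \<open>distr_fun_SUP\<close>.\<close>

lemma K_fun_SUP:
  assumes M: "sigma_finite_measure M"
    and F: "\<And>n::nat. F n \<in> borel_measurable M" and u: "u \<in> borel_measurable M"
    and ae: "AE x in M. incseq (\<lambda>n. F n x) \<and> u x = (SUP n. F n x)"
  shows "K_fun M u t = (SUP n. K_fun M (F n) t)"
proof -
  note [measurable] = distr_fun_borel_measurable[OF M F]
  have inc: "distr_fun M (F m) y \<le> distr_fun M (F n) y" if "m \<le> n" for m n y
  proof (rule distr_fun_mono_AE[OF F])
    show "AE x in M. F m x \<le> F n x" using ae by eventually_elim (use that in \<open>auto simp: incseq_def\<close>)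
  qed
  have "K_fun M u t = (\<integral>\<^sup>+ y. (SUP n. min (ennreal t) (distr_fun M (F n) y) * indicator {0<..} y) \<partial>lborel)"
    unfolding K_fun_def distr_fun_SUP[OF F u ae]
    by (intro nn_integral_cong) (simp add: inf_min[symmetric] inf_SUP SUP_mult_right_ennreal)
  also have "\<dots> = (SUP n. K_fun M (F n) t)"
    unfolding K_fun_def
    by (intro nn_integral_monotone_convergence_SUP)
       (auto simp: incseq_def le_fun_def inc intro!: mult_right_mono min.mono)
  finally show ?thesis .
qed

text \<open>For positive \<open>a\<close> this is the substitution of \<open>a * y\<close> for
  \<open>y\<close> in the defining integral.\<close>

lemma K_fun_cmult:
  assumes M: "sigma_finite_measure M" and u: "u \<in> borel_measurable M" and a: "0 \<le> a"
  shows "K_fun M (\<lambda>x. ennreal a * u x) t = ennreal a * K_fun M u t"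
proof (cases "a = 0")
  case True
  then show ?thesis by (simp add: K_fun_def distr_fun_def)
next
  case False
  then have a: "0 < a" using a by simp
  note [measurable] = distr_fun_borel_measurable[OF M u] distr_fun_borel_measurable[OF M]
  have d: "distr_fun M (\<lambda>x. ennreal a * u x) (a * y) = distr_fun M u y" if "0 < y" for y
  proof -
    have "ennreal (a * y) < ennreal a * u x \<longleftrightarrow> ennreal y < u x" for x
      using a that by (cases "u x") (auto simp: ennreal_mult[symmetric] ennreal_less_iff ennreal_mult_top)
    then show ?thesis unfolding distr_fun_def by simp
  qed
  have "K_fun M (\<lambda>x. ennreal a * u x) t = ennreal \<bar>a\<bar> * (\<integral>\<^sup>+ y. min (ennreal t) (distr_fun M (\<lambda>x. ennreal a * u x) (0 + a * y)) * indicator {0<..} (0 + a * y) \<partial>lborel)"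
    unfolding K_fun_def by (rule nn_integral_real_affine) (use a u in auto)
  also have "(\<integral>\<^sup>+ y. min (ennreal t) (distr_fun M (\<lambda>x. ennreal a * u x) (0 + a * y)) * indicator {0<..} (0 + a * y) \<partial>lborel) = K_fun M u t"
    unfolding K_fun_def using a by (intro nn_integral_cong) (auto simp: indicator_def d zero_less_mult_iff)
  finally show ?thesis using a by simp
qed

section \<open>Estimates for the K-functional\<close>

text \<open>A Chebyshev-type bound: the integrand is non-increasing in the level, hence on levels
  below \<open>y\<close> at least its value at \<open>y\<close>.\<close>

lemma K_fun_ge:
  assumes u: "u \<in> borel_measurable M" and y: "0 < y"
  shows "ennreal y * min (ennreal t) (distr_fun M u y) \<le> K_fun M u t"
proof -
  have "ennreal y * min (ennreal t) (distr_fun M u y) = (\<integral>\<^sup>+ z. min (ennreal t) (distr_fun M u y) * indicator {0<..<y} z \<partial>lborel)"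
    using y by (subst nn_integral_cmult_indicator) (auto simp: mult.commute)
  also have "\<dots> \<le> K_fun M u t"
    unfolding K_fun_def
    by (intro nn_integral_mono) (auto simp: indicator_def intro!: min.coboundedI2 distr_fun_antimono u)
  finally show ?thesis .
qed

lemma K_fun_indicator:
  assumes E: "E \<in> sets M"
  shows "K_fun M (indicator E) t = min (ennreal t) (emeasure M E)"
proof -
  have "min (ennreal t) (distr_fun M (indicator E) y) * indicator {0<..} y
      = min (ennreal t) (emeasure M E) * indicator {0<..<1} y" for y
  proof -
    have "{x \<in> space M. ennreal y < indicator E x} = (if y < 1 then E else {})" if "0 < y"
      using that sets.sets_into_space[OF E] by (auto simp: indicator_def ennreal_less_one_iff)
    then show ?thesis by (auto simp: distr_fun_def indicator_def)
  qed
  then show ?thesis by (simp add: K_fun_def nn_integral_cmult_indicator)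
qed

text \<open>The distribution function of \<open>u\<close> cut off to \<open>E\<close> is bounded
  both by the measure of \<open>E\<close> and by the distribution function of \<open>u\<close>; the
  layer-cake formula at level 0 integrates this bound.\<close>

lemma nn_integral_le_K_fun:
  assumes M: "sigma_finite_measure M" and u[measurable]: "u \<in> borel_measurable M"
    and E[measurable]: "E \<in> sets M" and a: "emeasure M E = ennreal a"
  shows "(\<integral>\<^sup>+ x \<in> E. u x \<partial>M) \<le> K_fun M u a"
proof -
  have "(\<integral>\<^sup>+ x \<in> E. u x \<partial>M) = (\<integral>\<^sup>+ y \<in> {0<..}. distr_fun M (\<lambda>x. u x * indicator E x) y \<partial>lborel)"
    using nn_integral_layer_cake[OF M, of "\<lambda>x. u x * indicator E x" 0] by simp
  also have "\<dots> \<le> K_fun M u a"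
    unfolding K_fun_def
  proof (intro nn_integral_mono)
    fix y :: real
    show "distr_fun M (\<lambda>x. u x * indicator E x) y * indicator {0<..} y \<le> min (ennreal a) (distr_fun M u y) * indicator {0<..} y"
      unfolding distr_fun_def a[symmetric]
      by (auto simp: indicator_def intro!: emeasure_mono split: if_splits)
  qed
  finally show ?thesis .
qed

lemma max_rearr_eq:
  assumes "sigma_finite_measure M" "(\<lambda>x. ecmod (f x)) \<in> borel_measurable M"
  shows "max_rearr M f t = K_fun M (\<lambda>x. ecmod (f x)) t / ennreal t"
  unfolding max_rearr_def nn_integral_rearr[OF assms] ..

text \<open>Each minimum of \<open>t\<close> with a constant, divided by \<open>t\<close>, is
  non-increasing in \<open>t\<close>; this survives integration over the levels.\<close>

lemma max_rearr_antimono: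
  assumes M: "sigma_finite_measure M" and u: "(\<lambda>x. ecmod (f x)) \<in> borel_measurable M"
    and st: "0 < s" "s \<le> t"
  shows "max_rearr M f t \<le> max_rearr M f s"
proof -
  note [measurable] = distr_fun_borel_measurable[OF M u]
  have *: "min (ennreal t) c \<le> ennreal (t / s) * min (ennreal s) c" for c
  proof (cases c)
    case (real r)
    have "min t r \<le> t / s * min s r"
      using st real mult_right_mono[of 1 "t / s" r] by (cases "s \<le> r") (auto simp: min_def field_simps)
    then have "ennreal (min t r) \<le> ennreal (t / s * min s r)" by (rule ennreal_leI)
    then show ?thesis
      using st real by (simp add: ennreal_mult[symmetric] min_ennreal)
  qed (use st in \<open>auto simp: ennreal_mult[symmetric]\<close>)
  have "K_fun M (\<lambda>x. ecmod (f x)) t \<le> (\<integral>\<^sup>+ y. ennreal (t / s) * (min (ennreal s) (distr_fun M (\<lambda>x. ecmod (f x)) y) * indicator {0<..} y) \<partial>lborel)"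
    unfolding K_fun_def using * by (intro nn_integral_mono) (auto simp: indicator_def)
  also have "\<dots> = ennreal (t / s) * K_fun M (\<lambda>x. ecmod (f x)) s"
    unfolding K_fun_def by (rule nn_integral_cmult) measurable
  finally have "max_rearr M f t \<le> ennreal (t / s) * K_fun M (\<lambda>x. ecmod (f x)) s / ennreal t"
    unfolding max_rearr_eq[OF M u] by (rule divide_right_mono_ennreal)
  also have "\<dots> = max_rearr M f s"
    unfolding max_rearr_eq[OF M u] using st
    by (cases "K_fun M (\<lambda>x. ecmod (f x)) s")
       (auto simp: ennreal_mult[symmetric] divide_ennreal ennreal_mult_top ennreal_top_divide)
  finally show ?thesis .
qed

section \<open>The norm of \<open>L\<^sup>q\<close> on the half-line\<close>

lemma ennpowr_ennreal: "0 \<le> x \<Longrightarrow> ennpowr (ennreal x) a = ennreal (x powr a)"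
  by (simp add: ennpowr_def)

lemma ennpowr_top [simp]: "ennpowr top a = top" "ennpowr \<infinity> a = top"
  by (simp_all add: ennpowr_def)

lemma ennpowr_0 [simp]: "ennpowr 0 a = 0"
  by (simp add: ennpowr_def)

lemma ennpowr_eq_0_iff [simp]: "ennpowr x a = 0 \<longleftrightarrow> x = 0"
  by (cases x) (auto simp: ennpowr_ennreal)

lemma ennpowr_eq_top_iff [simp]: "ennpowr x a = top \<longleftrightarrow> x = top"
  by (auto simp: ennpowr_def)

lemma ennpowr_less_top_iff [simp]: "ennpowr x a < top \<longleftrightarrow> x < top"
  by (metis ennpowr_eq_top_iff less_top)

lemma ennpowr_mono:
  assumes "0 \<le> a" "x \<le> y"
  shows "ennpowr x a \<le> ennpowr y a"
proof (cases y)
  case (real r)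
  then obtain s where "x = ennreal s" "0 \<le> s" using assms by (cases x) (auto simp: top_unique)
  then show ?thesis using assms real by (auto simp: ennpowr_ennreal intro!: ennreal_leI powr_mono2)
qed simp

lemma ennpowr_ennpowr: "0 < b \<Longrightarrow> ennpowr (ennpowr x a) b = ennpowr x (a * b)"
  by (cases x) (auto simp: ennpowr_ennreal powr_powr)

lemma ennpowr_one [simp]: "ennpowr x 1 = x"
  by (cases x) (auto simp: ennpowr_ennreal)

lemma ennpowr_mult:
  assumes "0 < a"
  shows "ennpowr (x * y) a = ennpowr x a * ennpowr y a"
proof (cases "x = top \<or> y = top")
  case True
  then show ?thesis by (auto simp: ennreal_mult_top ennreal_top_mult ennreal_mult_eq_top_iff)
next
  case False
  then show ?thesis
    by (cases x; cases y) (auto simp: ennpowr_ennreal ennreal_mult[symmetric] powr_mult)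
qed

text \<open>The power with exponent \<open>a\<close> is monotone with monotone inverse, the power
  with exponent \<open>1 / a\<close>, so it preserves suprema.\<close>

lemma ennpowr_SUP:
  fixes f :: "nat \<Rightarrow> ennreal"
  assumes a: "0 < a"
  shows "ennpowr (SUP n. f n) a = (SUP n. ennpowr (f n) a)"
proof (rule antisym)
  let ?z = "SUP n. ennpowr (f n) a"
  have "f n \<le> ennpowr ?z (1 / a)" for n
  proof -
    have "f n = ennpowr (ennpowr (f n) a) (1 / a)" using a by (simp add: ennpowr_ennpowr)
    also have "\<dots> \<le> ennpowr ?z (1 / a)" using a by (intro ennpowr_mono SUP_upper) auto
    finally show ?thesis .
  qed
  then have "ennpowr (SUP n. f n) a \<le> ennpowr (ennpowr ?z (1 / a)) a"
    using a by (intro ennpowr_mono SUP_least) auto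
  then show "ennpowr (SUP n. f n) a \<le> ?z" using a by (simp add: ennpowr_ennpowr)
  show "?z \<le> ennpowr (SUP n. f n) a" using a by (intro SUP_least ennpowr_mono SUP_upper) auto
qed

lemma borel_measurable_ennpowr [measurable]:
  assumes [measurable]: "f \<in> borel_measurable M"
  shows "(\<lambda>x. ennpowr (f x) a) \<in> borel_measurable M"
  unfolding ennpowr_def infinity_ennreal_def by measurable

section \<open>Minkowski's inequality\<close>

text \<open>Convexity of the power at the points \<open>x / F\<close> and \<open>y / G\<close> with
  weights \<open>F / (F + G)\<close> and \<open>G / (F + G)\<close>. In this pointwise form, with
  \<open>F\<close> and \<open>G\<close> close to the norms, integration gives Minkowski's
  inequality.\<close>

lemma powr_add_le:
  fixes x y F G a :: real
  assumes "0 \<le> x" "0 \<le> y" "0 < F" "0 < G" "1 \<le> a"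
  shows "(x + y) powr a \<le> (F + G) powr (a - 1) * (F powr (1 - a) * x powr a + G powr (1 - a) * y powr a)"
proof -
  \<comment> \<open>Covers the case that one summand is 0, using only that the power with exponent
    \<open>a - 1\<close> is non-decreasing.\<close>
  have edge: "z powr a \<le> (H + H') powr (a - 1) * (H powr (1 - a) * z powr a)"
    if "0 < H" "0 < H'" for z H H' :: real
  proof -
    have "1 = H powr (a - 1) * H powr (1 - a)" using that by (simp add: powr_add[symmetric])
    also have "\<dots> \<le> (H + H') powr (a - 1) * H powr (1 - a)"
      using that assms by (intro mult_right_mono powr_mono2) auto
    finally show ?thesis
      using mult_right_mono[of 1 "(H + H') powr (a - 1) * H powr (1 - a)" "z powr a"] by (simp add: mult.assoc)
  qed
  show ?thesis
  proof (cases "x = 0 \<or> y = 0")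
    case True
    then show ?thesis using edge[of F G y] edge[of F G x] edge[of G F y] assms by (auto simp: add.commute)
  next
    case False
    with assms have xy: "0 < x" "0 < y" by auto
    define t where "t = G / (F + G)"
    have t: "0 \<le> t" "t \<le> 1" "1 - t = F / (F + G)" using assms by (auto simp: t_def field_simps)
    have eq: "S powr a * (F / S * (x / F) powr a + G / S * (y / G) powr a)
        = S powr (a - 1) * (F powr (1 - a) * x powr a + G powr (1 - a) * y powr a)" if "0 < S" for S
      using that xy assms by (simp add: powr_divide powr_diff field_simps)
    have "((1 - t) *\<^sub>R (x / F) + t *\<^sub>R (y / G)) powr a \<le> (1 - t) * (x / F) powr a + t * (y / G) powr a"
      using powr_convex[OF assms(5)] t xy assms by (intro convex_onD) auto
    also have "(1 - t) *\<^sub>R (x / F) + t *\<^sub>R (y / G) = (x + y) / (F + G)"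
      unfolding t(3) using assms by (simp add: t_def add_divide_distrib)
    finally have "(F + G) powr a * ((x + y) / (F + G)) powr a
        \<le> (F + G) powr a * ((1 - t) * (x / F) powr a + t * (y / G) powr a)"
      by (rule mult_left_mono) simp
    also have "(F + G) powr a * ((x + y) / (F + G)) powr a = (x + y) powr a"
      using xy assms by (simp add: powr_divide)
    also have "(F + G) powr a * ((1 - t) * (x / F) powr a + t * (y / G) powr a)
        = (F + G) powr (a - 1) * (F powr (1 - a) * x powr a + G powr (1 - a) * y powr a)"
      unfolding t(3) unfolding t_def using eq[of "F + G"] assms by simp
    finally show ?thesis .
  qed
qed

lemma ennpowr_add_le:
  fixes F G a :: real
  assumes "0 < F" "0 < G" "1 \<le> a"
  shows "ennpowr (x + y) a \<le> ennreal ((F + G) powr (a - 1) * F powr (1 - a)) * ennpowr x a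
    + ennreal ((F + G) powr (a - 1) * G powr (1 - a)) * ennpowr y a"
proof (cases "x = top \<or> y = top")
  case True
  then show ?thesis using assms by (auto simp: ennreal_mult_top)
next
  case False
  then obtain r s where "x = ennreal r" "0 \<le> r" "y = ennreal s" "0 \<le> s" by (metis ennreal_cases)
  then show ?thesis
    using powr_add_le[of r s F G a] assms
    by (auto simp: ennpowr_ennreal ennreal_plus[symmetric] ennreal_mult[symmetric] algebra_simps
        simp del: ennreal_plus intro!: ennreal_leI)
qed

text \<open>Integrating the convexity bound with \<open>F\<close> and \<open>G\<close> just above
  the two norms bounds the integral on the left by the power of \<open>F + G\<close> with exponent
  \<open>a\<close>.\<close>

lemma Minkowski_nn_integral:
  assumes [measurable]: "f \<in> borel_measurable M" "g \<in> borel_measurable M" and a: "1 \<le> a"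
  shows "ennpowr (\<integral>\<^sup>+ x. ennpowr (f x + g x) a \<partial>M) (1 / a)
    \<le> ennpowr (\<integral>\<^sup>+ x. ennpowr (f x) a \<partial>M) (1 / a) + ennpowr (\<integral>\<^sup>+ x. ennpowr (g x) a \<partial>M) (1 / a)"
    (is "?N (\<lambda>x. f x + g x) \<le> ?N f + ?N g")
proof (rule ennreal_le_epsilon)
  fix e :: real assume fin: "?N f + ?N g < top" and e: "0 < e"
  have N: "(\<integral>\<^sup>+ x. ennpowr (h x) a \<partial>M) \<le> ennreal (r powr a)" if "?N h \<le> ennreal r" "0 < r" for h r
  proof -
    have "(\<integral>\<^sup>+ x. ennpowr (h x) a \<partial>M) = ennpowr (?N h) a" using a by (simp add: ennpowr_ennpowr)
    also have "\<dots> \<le> ennpowr (ennreal r) a" using that a by (intro ennpowr_mono) auto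
    finally show ?thesis using that by (simp add: ennpowr_ennreal)
  qed
  obtain F0 G0 where FG0: "?N f = ennreal F0" "0 \<le> F0" "?N g = ennreal G0" "0 \<le> G0"
    using fin by (cases "?N f"; cases "?N g") auto
  \<comment> \<open>The added \<open>e / 2\<close> keeps both numbers positive, as
    \<open>ennpowr_add_le\<close> demands, even if a norm vanishes.\<close>
  define F G where FG: "F = F0 + e / 2" "G = G0 + e / 2"
  have pos: "0 < F" "0 < G" using FG FG0 e by auto
  have sum: "?N f + ?N g + ennreal e = ennreal (F + G)"
    using FG FG0 e by (simp add: ennreal_plus[symmetric] del: ennreal_plus)
  let ?c = "\<lambda>H. (F + G) powr (a - 1) * H powr (1 - a)"
  have "(\<integral>\<^sup>+ x. ennpowr (f x + g x) a \<partial>M)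
    \<le> (\<integral>\<^sup>+ x. ennreal (?c F) * ennpowr (f x) a + ennreal (?c G) * ennpowr (g x) a \<partial>M)"
    using pos a by (intro nn_integral_mono ennpowr_add_le)
  also have "\<dots> = ennreal (?c F) * (\<integral>\<^sup>+ x. ennpowr (f x) a \<partial>M) + ennreal (?c G) * (\<integral>\<^sup>+ x. ennpowr (g x) a \<partial>M)"
    by (simp add: nn_integral_add nn_integral_cmult)
  also have "\<dots> \<le> ennreal (?c F) * ennreal (F powr a) + ennreal (?c G) * ennreal (G powr a)"
    using pos FG FG0 e by (intro add_mono mult_left_mono N) (auto intro!: ennreal_leI)
  also have "\<dots> = ennreal ((F + G) powr (a - 1) * (F powr (1 - a) * F powr a + G powr (1 - a) * G powr a))"
    by (simp add: ennreal_mult[symmetric] ennreal_plus[symmetric] algebra_simps del: ennreal_plus)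
  also have "F powr (1 - a) * F powr a + G powr (1 - a) * G powr a = F + G"
    using pos by (simp add: powr_add[symmetric])
  also have "(F + G) powr (a - 1) * (F + G) = (F + G) powr a"
    using pos by (simp add: powr_diff)
  finally have "?N (\<lambda>x. f x + g x) \<le> ennpowr (ennreal ((F + G) powr a)) (1 / a)"
    using a by (intro ennpowr_mono) auto
  also have "\<dots> = ennreal (F + G)" using pos a by (simp add: ennpowr_ennreal powr_powr)
  finally show "?N (\<lambda>x. f x + g x) \<le> ?N f + ?N g + ennreal e" unfolding sum .
qed

section \<open>Norm properties, uniformly in the exponent\<close>

abbreviation halfline :: "real measure" where
  "halfline \<equiv> lebesgue_on {0<..}"

lemma recip_top [simp]: "recip top = 0"
  by (simp add: recip_def)

lemma exponent_cases:
  assumes "1 \<le> (q::ennreal)"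
  obtains "q = \<infinity>" | a where "q = ennreal a" "1 \<le> a" "recip q = 1 / a"
proof (cases q)
  case (real r)
  then have "1 \<le> r" using assms by simp
  moreover have "recip q = 1 / r"
    using real \<open>1 \<le> r\<close> divide_ennreal[of 1 r] by (simp add: recip_def)
  ultimately show ?thesis using that real by blast
next
  case top
  then show ?thesis using that by simp
qed

lemma Lq_norm_top: "Lq_norm \<infinity> g = esssup halfline g"
  by (simp add: Lq_norm_def)

lemma Lq_norm_real:
  "1 \<le> a \<Longrightarrow> Lq_norm (ennreal a) g = ennpowr (\<integral>\<^sup>+ t. ennpowr (g t) a \<partial>halfline) (1 / a)"
  by (simp add: Lq_norm_def)

lemma esssup_ennreal_cmult:
  fixes f :: "'a \<Rightarrow> ennreal"
  assumes [measurable]: "f \<in> borel_measurable M" and "0 < c"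
  shows "esssup M (\<lambda>x. ennreal c * f x) = ennreal c * esssup M f"
proof (rule antisym)
  have "AE x in M. f x \<le> esssup M f" by (rule esssup_AE)
  then show "esssup M (\<lambda>x. ennreal c * f x) \<le> ennreal c * esssup M f"
    by (intro esssup_I) (auto elim!: eventually_mono intro!: mult_left_mono)
  have eq: "ennreal (1 / c) * (ennreal c * y) = y" for y
    using \<open>0 < c\<close> by (simp add: mult.assoc[symmetric] ennreal_mult[symmetric])
  have "AE x in M. ennreal c * f x \<le> esssup M (\<lambda>x. ennreal c * f x)" by (rule esssup_AE)
  then have "AE x in M. f x \<le> ennreal (1 / c) * esssup M (\<lambda>x. ennreal c * f x)"
    by eventually_elim (metis eq mult_left_mono zero_le)
  then have "esssup M f \<le> ennreal (1 / c) * esssup M (\<lambda>x. ennreal c * f x)"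
    by (intro esssup_I) auto
  then have "ennreal c * esssup M f \<le> ennreal c * (ennreal (1 / c) * esssup M (\<lambda>x. ennreal c * f x))"
    by (rule mult_left_mono) simp
  then show "ennreal c * esssup M f \<le> esssup M (\<lambda>x. ennreal c * f x)"
    using eq by (simp add: mult.left_commute[of "ennreal c"])
qed

lemma Lq_norm_mono_AE:
  assumes q: "1 \<le> q" and f: "f \<in> borel_measurable halfline"
    and ae: "AE t in halfline. f t \<le> g t"
  shows "Lq_norm q f \<le> Lq_norm q g"
  using q
proof (cases rule: exponent_cases)
  case 1
  then show ?thesis using f ae by (simp add: Lq_norm_top[simplified] esssup_AE_mono)
next
  case (2 a)
  then show ?thesis
    using ae by (auto simp: Lq_norm_real intro!: ennpowr_mono nn_integral_mono_AE elim!: eventually_mono)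
qed

lemma Lq_norm_add_le:
  assumes q: "1 \<le> q" and [measurable]: "f \<in> borel_measurable halfline" "g \<in> borel_measurable halfline"
  shows "Lq_norm q (\<lambda>t. f t + g t) \<le> Lq_norm q f + Lq_norm q g"
  using q
proof (cases rule: exponent_cases)
  case 1
  have "AE t in halfline. f t \<le> esssup halfline f" "AE t in halfline. g t \<le> esssup halfline g"
    by (rule esssup_AE)+
  then have "AE t in halfline. f t + g t \<le> esssup halfline f + esssup halfline g"
    by eventually_elim (rule add_mono)
  then show ?thesis unfolding 1 Lq_norm_top by (intro esssup_I) auto
next
  case (2 a)
  then show ?thesis using Minkowski_nn_integral[of f halfline g a] by (simp add: Lq_norm_real)
qed

lemma Lq_norm_eq_0_iff:
  assumes q: "1 \<le> q" and [measurable]: "f \<in> borel_measurable halfline"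
  shows "Lq_norm q f = 0 \<longleftrightarrow> (AE t in halfline. f t = 0)"
  using q
proof (cases rule: exponent_cases)
  case 1
  have "esssup halfline f = 0 \<longleftrightarrow> (AE t in halfline. f t = 0)"
  proof
    assume "esssup halfline f = 0"
    then show "AE t in halfline. f t = 0" using esssup_AE[of f halfline] by simp
  next
    assume "AE t in halfline. f t = 0"
    then have "esssup halfline f \<le> 0" by (intro esssup_I) (auto elim!: eventually_mono)
    then show "esssup halfline f = 0" by simp
  qed
  then show ?thesis unfolding 1 Lq_norm_top .
next
  case (2 a)
  then show ?thesis by (simp add: Lq_norm_real nn_integral_0_iff_AE)
qed

lemma Lq_norm_cmult:
  assumes q: "1 \<le> q" and [measurable]: "f \<in> borel_measurable halfline" and c: "0 \<le> c"
  shows "Lq_norm q (\<lambda>t. ennreal c * f t) = ennreal c * Lq_norm q f"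
proof (cases "c = 0")
  case True
  then show ?thesis using Lq_norm_eq_0_iff[OF q, of "\<lambda>t. 0"] by simp
next
  case False
  with c have c: "0 < c" by simp
  from q show ?thesis
  proof (cases rule: exponent_cases)
    case 1
    then show ?thesis unfolding 1 Lq_norm_top by (intro esssup_ennreal_cmult c) auto
  next
    case (2 a)
    then show ?thesis using c
      by (simp add: Lq_norm_real ennpowr_mult nn_integral_cmult ennpowr_ennpowr)
  qed
qed

text \<open>Monotone convergence for a finite exponent. For the essential supremum, countably many
  almost-everywhere bounds hold simultaneously.\<close>

lemma Lq_norm_SUP:
  assumes q: "1 \<le> q" and [measurable]: "\<And>n::nat. F n \<in> borel_measurable halfline"
    and inc: "\<And>t. 0 < t \<Longrightarrow> incseq (\<lambda>n. F n t)"
  shows "Lq_norm q (\<lambda>t. SUP n. F n t) = (SUP n. Lq_norm q (F n))"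
  using q
proof (cases rule: exponent_cases)
  case 1
  have "esssup halfline (\<lambda>t. SUP n. F n t) = (SUP n. esssup halfline (F n))"
  proof (rule antisym)
    have "AE t in halfline. \<forall>n. F n t \<le> esssup halfline (F n)"
      unfolding AE_all_countable using esssup_AE by blast
    then have "AE t in halfline. (SUP n. F n t) \<le> (SUP n. esssup halfline (F n))"
      by eventually_elim (auto intro!: SUP_mono)
    then show "esssup halfline (\<lambda>t. SUP n. F n t) \<le> (SUP n. esssup halfline (F n))"
      by (intro esssup_I) auto
    show "(SUP n. esssup halfline (F n)) \<le> esssup halfline (\<lambda>t. SUP n. F n t)"
      by (intro SUP_least esssup_mono) (auto intro: SUP_upper)
  qed
  then show ?thesis unfolding 1 Lq_norm_top .
next
  case (2 a)
  have "(\<integral>\<^sup>+ t. ennpowr (SUP n. F n t) a \<partial>halfline) = (SUP n. \<integral>\<^sup>+ t. ennpowr (F n t) a \<partial>halfline)"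
    using 2 inc
    by (subst nn_integral_monotone_convergence_SUP_AE[symmetric])
       (auto simp: ennpowr_SUP incseq_def intro!: AE_I2 ennpowr_mono)
  then show ?thesis using 2 by (simp add: Lq_norm_real ennpowr_SUP)
qed

section \<open>Slowly varying weights\<close>

text \<open>A non-decreasing function equivalent to \<open>t powr e * b t\<close> is on
  \<open>(0,1]\<close> at most its value at 1. The two bounds on \<open>[1,\<infinity>)\<close> that
  follow arise from the same comparison with the value at 1.\<close>

lemma slowly_varying_le_near_0:
  assumes "slowly_varying b" "0 < e"
  obtains C where "0 < C" "\<And>t. 0 < t \<Longrightarrow> t \<le> 1 \<Longrightarrow> b t \<le> C * t powr (- e)"
proof -
  from assms obtain h c C where h: "mono_on {0<..} h" and cC: "0 < c" "0 < C"
    and ap: "\<And>t. 0 < t \<Longrightarrow> c * h t \<le> t powr e * b t \<and> t powr e * b t \<le> C * h t"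
    unfolding slowly_varying_def approx_pos_def by metis
  have b1: "0 < b 1" using assms by (simp add: slowly_varying_def)
  show ?thesis
  proof (rule that)
    show "0 < C / c * b 1" using cC b1 by simp
    fix t :: real assume t: "0 < t" "t \<le> 1"
    have "t powr e * b t \<le> C * h t"
      using ap[OF t(1)] by simp
    also have "\<dots> \<le> C * h 1"
      using mono_onD[OF h, of t 1] t cC by (intro mult_left_mono) auto
    also have "\<dots> \<le> C / c * b 1"
      using ap[of 1] cC by (simp add: field_simps)
    finally have "t powr (- e) * (t powr e * b t) \<le> t powr (- e) * (C / c * b 1)"
      by (rule mult_left_mono) simp
    then show "b t \<le> C / c * b 1 * t powr (- e)"
      using t by (simp add: mult.assoc[symmetric] powr_add[symmetric]) (simp add: ac_simps)
  qed
qed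

lemma slowly_varying_ge_near_infinity:
  assumes "slowly_varying b" "0 < e"
  obtains c where "0 < c" "\<And>t. 1 \<le> t \<Longrightarrow> c * t powr (- e) \<le> b t"
proof -
  from assms obtain h c C where h: "mono_on {0<..} h" and cC: "0 < c" "0 < C"
    and ap: "\<And>t. 0 < t \<Longrightarrow> c * h t \<le> t powr e * b t \<and> t powr e * b t \<le> C * h t"
    unfolding slowly_varying_def approx_pos_def by metis
  have b1: "0 < b 1" using assms by (simp add: slowly_varying_def)
  show ?thesis
  proof (rule that)
    show "0 < c / C * b 1" using cC b1 by simp
    fix t :: real assume t: "1 \<le> t"
    have "c / C * b 1 \<le> c * h 1"
      using ap[of 1] cC by (simp add: field_simps)
    also have "\<dots> \<le> c * h t"
      using mono_onD[OF h, of 1 t] t cC by (intro mult_left_mono) auto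
    also have "\<dots> \<le> t powr e * b t"
      using ap[of t] t by simp
    finally have "t powr (- e) * (c / C * b 1) \<le> t powr (- e) * (t powr e * b t)"
      by (rule mult_left_mono) simp
    then show "c / C * b 1 * t powr (- e) \<le> b t"
      using t by (simp add: mult.assoc[symmetric] powr_add[symmetric]) (simp add: ac_simps)
  qed
qed

lemma slowly_varying_le_near_infinity:
  assumes "slowly_varying b" "0 < e"
  obtains C where "0 < C" "\<And>t. 1 \<le> t \<Longrightarrow> b t \<le> C * t powr e"
proof -
  from assms obtain h c C where h: "antimono_on {0<..} h" and cC: "0 < c" "0 < C"
    and ap: "\<And>t. 0 < t \<Longrightarrow> c * h t \<le> t powr (- e) * b t \<and> t powr (- e) * b t \<le> C * h t"
    unfolding slowly_varying_def approx_pos_def by metis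
  have b1: "0 < b 1" using assms by (simp add: slowly_varying_def)
  show ?thesis
  proof (rule that)
    show "0 < C / c * b 1" using cC b1 by simp
    fix t :: real assume t: "1 \<le> t"
    have "t powr (- e) * b t \<le> C * h t"
      using ap[of t] t by simp
    also have "\<dots> \<le> C * h 1"
      using h t cC by (intro mult_left_mono) (auto simp: monotone_on_def)
    also have "\<dots> \<le> C / c * b 1"
      using ap[of 1] cC by (simp add: field_simps)
    finally have "t powr e * (t powr (- e) * b t) \<le> t powr e * (C / c * b 1)"
      by (rule mult_left_mono) simp
    then show "b t \<le> C / c * b 1 * t powr e"
      using t by (simp add: mult.assoc[symmetric] powr_add[symmetric]) (simp add: ac_simps)
  qed
qed

section \<open>Norms of power functions on the two parts of the half-line\<close>

lemma borel_measurable_halfline: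
  "g \<in> borel_measurable borel \<Longrightarrow> g \<in> borel_measurable halfline"
  by (intro measurable_restrict_space1 measurable_completion) simp

lemma indicator_halfline [measurable]:
  "(\<lambda>t. indicator {a<..<c} t :: ennreal) \<in> borel_measurable halfline"
  "(\<lambda>t. indicator {a<..} t :: ennreal) \<in> borel_measurable halfline"
  by (rule borel_measurable_halfline; measurable)+

lemma nn_integral_halfline: "(\<integral>\<^sup>+ t. g t \<partial>halfline) = (\<integral>\<^sup>+ t. g t * indicator {0<..} t \<partial>lebesgue)"
  by (rule nn_integral_restrict_space) simp

lemma AE_halfline_iff: "(AE t in halfline. P t) \<longleftrightarrow> (AE t in lebesgue. 0 < t \<longrightarrow> P t)"
  by (subst AE_restrict_space_iff) auto

lemma AE_halfline_not_greater: "\<not> (AE t in halfline. t \<le> a)"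
proof
  assume "AE t in halfline. t \<le> a"
  then have "AE t in lebesgue. t \<notin> {max 0 a<..<max 0 a + 1}"
    unfolding AE_halfline_iff by eventually_elim auto
  then have "emeasure lebesgue {max 0 a<..<max 0 a + 1} = 0"
    by (subst (asm) AE_iff_null_sets[symmetric]) auto
  then show False by simp
qed

lemma AE_halfline_not_null: "AE t in halfline. P t \<Longrightarrow> 0 < a \<Longrightarrow> \<exists>t>0. t < a \<and> P t"
proof (rule ccontr)
  assume P: "AE t in halfline. P t" and a: "0 < a" "\<not> (\<exists>t>0. t < a \<and> P t)"
  from P have "AE t in lebesgue. t \<notin> {0<..<a}"
    unfolding AE_halfline_iff using a(2) by (auto elim!: eventually_mono)
  then have "emeasure lebesgue {0<..<a} = 0"
    by (subst (asm) AE_iff_null_sets[symmetric]) auto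
  then show False using a by simp
qed

text \<open>For a finite exponent \<open>a\<close> the power to be integrated is
  \<open>t powr (d * a - 1)\<close>, integrable near 0 because \<open>d * a\<close> is positive; for
  the essential supremum the function is bounded by 1.\<close>

lemma Lq_norm_powr_near_0:
  assumes q: "1 \<le> q" and d: "0 < d"
  shows "Lq_norm q (\<lambda>t. ennreal (t powr (d - recip q)) * indicator {0<..<1} t) < \<infinity>"
  using q
proof (cases rule: exponent_cases)
  case 1
  have "Lq_norm q (\<lambda>t. ennreal (t powr (d - recip q)) * indicator {0<..<1} t) \<le> 1"
    unfolding 1 Lq_norm_top using d
    by (intro esssup_I AE_I2 borel_measurable_halfline) (auto simp: indicator_def ennreal_le_1 powr_le1)
  then show ?thesis by (auto intro: le_less_trans)
next
  case (2 a)
  have "(\<integral>\<^sup>+ t. ennpowr (ennreal (t powr (d - recip q)) * indicator {0<..<1} t) a \<partial>halfline)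
      \<le> (\<integral>\<^sup>+ t. indicator {0..1} t * ennreal (t powr (d * a - 1)) \<partial>lborel)"
    unfolding nn_integral_halfline nn_integral_completion[of lborel, symmetric]
    using 2 by (intro nn_integral_mono) (auto simp: indicator_def ennpowr_ennreal powr_powr algebra_simps)
  also have "\<dots> = (\<integral>\<^sup>+ t. ennreal (indicator {0..1} t * t powr (d * a - 1)) \<partial>lborel)"
    by (intro nn_integral_cong) (auto simp: indicator_def)
  also have "\<dots> = ennreal (1 powr (d * a - 1 + 1) / (d * a - 1 + 1))"
    by (rule nn_integral_has_integral_lebesgue, simp, rule has_integral_powr_from_0) (use 2 d in auto)
  finally show ?thesis
    using 2 by (auto simp: Lq_norm_real intro: le_less_trans)
qed

lemma Lq_norm_powr_near_infinity:
  assumes q: "1 \<le> q" and d: "d < 0"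
  shows "Lq_norm q (\<lambda>t. ennreal (t powr (d - recip q)) * indicator {1<..} t) < \<infinity>"
  using q
proof (cases rule: exponent_cases)
  case 1
  have "Lq_norm q (\<lambda>t. ennreal (t powr (d - recip q)) * indicator {1<..} t) \<le> 1"
    unfolding 1 Lq_norm_top using d
    by (intro esssup_I AE_I2 borel_measurable_halfline) (auto simp: indicator_def ennreal_le_1 intro: powr_mono[of d 0, THEN order_trans])
  then show ?thesis by (auto intro: le_less_trans)
next
  case (2 a)
  have "(\<integral>\<^sup>+ t. ennpowr (ennreal (t powr (d - recip q)) * indicator {1<..} t) a \<partial>halfline)
      \<le> (\<integral>\<^sup>+ t. indicator {1..} t * ennreal (t powr (d * a - 1)) \<partial>lborel)"
    unfolding nn_integral_halfline nn_integral_completion[of lborel, symmetric]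
    using 2 by (intro nn_integral_mono) (auto simp: indicator_def ennpowr_ennreal powr_powr algebra_simps)
  also have "\<dots> = (\<integral>\<^sup>+ t. ennreal (indicator {1..} t * t powr (d * a - 1)) \<partial>lborel)"
    by (intro nn_integral_cong) (auto simp: indicator_def)
  also have "\<dots> = ennreal (- (1 powr (d * a - 1 + 1)) / (d * a - 1 + 1))"
    by (rule nn_integral_has_integral_lebesgue, simp, rule has_integral_powr_to_inf) (use 2 d in \<open>auto simp: mult_neg_pos\<close>)
  finally show ?thesis
    using 2 by (auto simp: Lq_norm_real intro: le_less_trans)
qed

text \<open>For a finite exponent the integrand dominates \<open>1 / t\<close>, whose integral
  diverges logarithmically; for the essential supremum the function is unbounded.\<close>

lemma Lq_norm_powr_infinite:
  assumes q: "1 \<le> q" and d: "0 < d"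
  shows "Lq_norm q (\<lambda>t. ennreal (t powr (d - recip q)) * indicator {1<..} t) = \<infinity>"
  using q
proof (cases rule: exponent_cases)
  case 1
  let ?g = "\<lambda>t::real. ennreal (t powr d) * indicator {1<..} t"
  have "esssup halfline ?g = \<infinity>"
  proof (rule ccontr)
    assume "esssup halfline ?g \<noteq> \<infinity>"
    then obtain r where r: "esssup halfline ?g = ennreal r" "0 \<le> r" by (cases "esssup halfline ?g") auto
    have "AE t in halfline. ?g t \<le> esssup halfline ?g" by (rule esssup_AE)
    then have "AE t in halfline. t \<le> max 1 (r powr (1 / d))"
    proof eventually_elim
      case (elim t)
      show ?case
      proof (cases "1 < t")
        case True
        then have "t powr d \<le> r" using elim r by simp
        then have "(t powr d) powr (1 / d) \<le> r powr (1 / d)" using d by (intro powr_mono2) auto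
        then show ?thesis using d True by (simp add: powr_powr)
      qed auto
    qed
    then show False using AE_halfline_not_greater by blast
  qed
  then show ?thesis unfolding 1 Lq_norm_top by simp
next
  case (2 a)
  let ?I = "\<integral>\<^sup>+ t. ennpowr (ennreal (t powr (d - recip q)) * indicator {1<..} t) a \<partial>halfline"
  \<comment> \<open>The integral of \<open>1 / t\<close> from 1 to \<open>exp n\<close> is exactly
    \<open>n\<close>.\<close>
  have "ennreal n \<le> ?I" if n: "0 \<le> n" for n
  proof -
    have "(\<integral>\<^sup>+ t. ennreal (1 / t) * indicator {1..exp n} t \<partial>lborel) = ennreal (ln (exp n) - ln 1)"
    proof (rule nn_integral_FTC_Icc)
      fix t :: real assume "t \<in> {1..exp n}"
      then show "(ln has_real_derivative 1 / t) (at t)"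
        by (intro DERIV_ln_divide) auto
    qed (use n in auto)
    then have "ennreal n = (\<integral>\<^sup>+ t. ennreal (1 / t) * indicator {1..exp n} t \<partial>lebesgue)"
      unfolding nn_integral_completion by simp
    also have "\<dots> \<le> ?I"
      unfolding nn_integral_halfline
    proof (rule nn_integral_mono_AE)
      have "AE t in lebesgue. t \<noteq> (1::real)" by (intro AE_completion AE_lborel_singleton)
      then show "AE t in lebesgue. ennreal (1 / t) * indicator {1..exp n} t
        \<le> ennpowr (ennreal (t powr (d - recip q)) * indicator {1<..} t) a * indicator {0<..} t"
      proof eventually_elim
        case (elim t)
        have "t powr (- 1) \<le> t powr (d * a - 1)" if "1 < t"
          using that d 2 by (intro powr_mono) auto
        then have "1 / t \<le> t powr (d * a - 1)" if "1 < t"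
          using that by (simp add: powr_minus_divide)
        then show ?case
          using elim 2 by (auto simp: indicator_def ennpowr_ennreal powr_powr algebra_simps intro!: ennreal_leI)
      qed
    qed
    finally show ?thesis .
  qed
  then have "?I = top"
    by (rule ennreal_eq_topI)
  then show ?thesis using 2 by (simp add: Lq_norm_real)
qed

section \<open>Finiteness of the weight near zero and near infinity\<close>

locale lorentz_karamata = sigma_finite_measure M
  for M :: "'a measure" +
  fixes q :: ennreal and b :: "real \<Rightarrow> real"
  assumes q: "1 \<le> q" and b: "slowly_varying b"
begin

text \<open>The parameter \<open>r\<close> stands for 1/p. It is an arbitrary real because the
  weight is also needed at 1/p - 1, which may be negative.\<close>

definition weight :: "real \<Rightarrow> real \<Rightarrow> ennreal" where
  "weight r t = ennreal (t powr (r - recip q) * b t)"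

text \<open>At \<open>r = 0\<close> this is the quantity in the condition for
  \<open>p = \<infinity>\<close>, and \<open>tail_norm 0\<close> is the one in the condition for
  \<open>p = 1\<close>.\<close>

definition head_norm :: "real \<Rightarrow> ennreal" where
  "head_norm r = Lq_norm q (\<lambda>t. weight r t * indicator {0<..<1} t)"

definition tail_norm :: "real \<Rightarrow> ennreal" where
  "tail_norm r = Lq_norm q (\<lambda>t. weight r t * indicator {1<..} t)"

lemma b_pos: "0 < t \<Longrightarrow> 0 < b t"
  using b by (simp add: slowly_varying_def)

lemma weight_measurable [measurable]: "weight r \<in> borel_measurable halfline"
proof -
  have [measurable]: "b \<in> borel_measurable halfline" using b by (simp add: slowly_varying_def)
  have [measurable]: "(\<lambda>t. t powr (r - recip q)) \<in> borel_measurable halfline"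
    by (rule borel_measurable_halfline) measurable
  show ?thesis unfolding weight_def[abs_def] by measurable
qed

lemma weight_pos: "0 < t \<Longrightarrow> 0 < weight r t"
  using b_pos by (simp add: weight_def)

text \<open>Absorbs a decay of order \<open>1 / t\<close> in the maximal function into the weight,
  which is why tails appear at \<open>r - 1\<close>.\<close>

lemma weight_diff_one: "0 < t \<Longrightarrow> weight (r - 1) t = weight r t * ennreal (1 / t)"
proof -
  assume t: "0 < t"
  have "t powr (r - 1 - recip q) = t powr (r - recip q) * t powr (- 1)"
    by (subst powr_add[symmetric]) (simp add: algebra_simps)
  then show ?thesis
    using t b_pos[OF t] by (simp add: weight_def ennreal_mult[symmetric] powr_minus_divide)
qed

text \<open>Half of the exponent \<open>r\<close> pays for the growth of \<open>b\<close> at 0; the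
  other half leaves a power with finite norm on \<open>(0,1)\<close>.\<close>

lemma head_norm_finite:
  assumes "0 < r"
  shows "head_norm r < \<infinity>"
proof -
  obtain C where C: "0 < C" "\<And>t. 0 < t \<Longrightarrow> t \<le> 1 \<Longrightarrow> b t \<le> C * t powr (- (r / 2))"
    using slowly_varying_le_near_0[OF b, of "r / 2"] assms by auto
  have "head_norm r \<le> Lq_norm q (\<lambda>t. ennreal C * (ennreal (t powr (r / 2 - recip q)) * indicator {0<..<1} t))"
    unfolding head_norm_def
  proof (intro Lq_norm_mono_AE q AE_I2)
    fix t :: real
    have "t powr (r - recip q) * b t \<le> C * t powr (r / 2 - recip q)" if "0 < t" "t < 1"
    proof -
      have "t powr (r - recip q) * b t \<le> t powr (r - recip q) * (C * t powr (- (r / 2)))"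
        using C(2)[of t] that by (intro mult_left_mono) auto
      also have "\<dots> = C * t powr (r / 2 - recip q)"
        using that by (simp add: powr_add[symmetric])
      finally show ?thesis .
    qed
    then show "weight r t * indicator {0<..<1} t \<le> ennreal C * (ennreal (t powr (r / 2 - recip q)) * indicator {0<..<1} t)"
      using C(1) by (auto simp: weight_def indicator_def ennreal_mult[symmetric] intro!: ennreal_leI)
  qed measurable
  also have "\<dots> = ennreal C * Lq_norm q (\<lambda>t. ennreal (t powr (r / 2 - recip q)) * indicator {0<..<1} t)"
    using C by (intro Lq_norm_cmult q borel_measurable_halfline) auto
  also have "\<dots> < \<infinity>"
    using Lq_norm_powr_near_0[OF q, of "r / 2"] assms by (simp add: ennreal_mult_less_top)
  finally show ?thesis .
qed

lemma tail_norm_finite: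
  assumes "r < 0"
  shows "tail_norm r < \<infinity>"
proof -
  obtain C where C: "0 < C" "\<And>t. 1 \<le> t \<Longrightarrow> b t \<le> C * t powr (- (r / 2))"
    using slowly_varying_le_near_infinity[OF b, of "- (r / 2)"] assms by auto
  have "tail_norm r \<le> Lq_norm q (\<lambda>t. ennreal C * (ennreal (t powr (r / 2 - recip q)) * indicator {1<..} t))"
    unfolding tail_norm_def
  proof (intro Lq_norm_mono_AE q AE_I2)
    fix t :: real
    have "t powr (r - recip q) * b t \<le> C * t powr (r / 2 - recip q)" if "1 < t"
    proof -
      have "t powr (r - recip q) * b t \<le> t powr (r - recip q) * (C * t powr (- (r / 2)))"
        using C(2)[of t] that by (intro mult_left_mono) auto
      also have "\<dots> = C * t powr (r / 2 - recip q)"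
        using that by (simp add: powr_add[symmetric])
      finally show ?thesis .
    qed
    then show "weight r t * indicator {1<..} t \<le> ennreal C * (ennreal (t powr (r / 2 - recip q)) * indicator {1<..} t)"
      using C(1) by (auto simp: weight_def indicator_def ennreal_mult[symmetric] intro!: ennreal_leI)
  qed measurable
  also have "\<dots> = ennreal C * Lq_norm q (\<lambda>t. ennreal (t powr (r / 2 - recip q)) * indicator {1<..} t)"
    using C by (intro Lq_norm_cmult q borel_measurable_halfline) auto
  also have "\<dots> < \<infinity>"
    using Lq_norm_powr_near_infinity[OF q, of "r / 2"] assms by (simp add: ennreal_mult_less_top)
  finally show ?thesis .
qed

text \<open>A possible decay of \<open>b\<close> costs at most half of the exponent, and the
  remaining positive \<open>r / 2\<close> still forces divergence.\<close>

lemma tail_norm_infinite: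
  assumes "0 < r"
  shows "tail_norm r = \<infinity>"
proof -
  obtain c where c: "0 < c" "\<And>t. 1 \<le> t \<Longrightarrow> c * t powr (- (r / 2)) \<le> b t"
    using slowly_varying_ge_near_infinity[OF b, of "r / 2"] assms by auto
  have "ennreal c * \<infinity> = ennreal c * Lq_norm q (\<lambda>t. ennreal (t powr (r / 2 - recip q)) * indicator {1<..} t)"
    using Lq_norm_powr_infinite[OF q, of "r / 2"] assms by simp
  also have "\<dots> = Lq_norm q (\<lambda>t. ennreal c * (ennreal (t powr (r / 2 - recip q)) * indicator {1<..} t))"
    using c by (intro Lq_norm_cmult[symmetric] q borel_measurable_halfline) auto
  also have "\<dots> \<le> tail_norm r"
    unfolding tail_norm_def
  proof (intro Lq_norm_mono_AE q AE_I2)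
    fix t :: real
    have "c * t powr (r / 2 - recip q) \<le> t powr (r - recip q) * b t" if "1 < t"
    proof -
      have "c * t powr (r / 2 - recip q) = t powr (r - recip q) * (c * t powr (- (r / 2)))"
        using that by (simp add: powr_add[symmetric])
      also have "\<dots> \<le> t powr (r - recip q) * b t"
        using c(2)[of t] that by (intro mult_left_mono) auto
      finally show ?thesis .
    qed
    then show "ennreal c * (ennreal (t powr (r / 2 - recip q)) * indicator {1<..} t) \<le> weight r t * indicator {1<..} t"
      using c(1) by (auto simp: weight_def indicator_def ennreal_mult[symmetric] intro!: ennreal_leI)
  next
    show "(\<lambda>t. ennreal c * (ennreal (t powr (r / 2 - recip q)) * indicator {1<..} t)) \<in> borel_measurable halfline"
      by (rule borel_measurable_halfline) measurable
  qed
  finally show ?thesis using c by (simp add: ennreal_mult_top top_unique)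
qed

end

section \<open>The Lorentz--Karamata functional\<close>

text \<open>The set where \<open>u\<close> is positive is the countable union of its superlevel sets
  at \<open>1 / Suc n\<close>, so these cannot all be null.\<close>

lemma distr_fun_pos_exists:
  assumes [measurable]: "u \<in> borel_measurable M" and "\<not> (AE x in M. u x = 0)"
  obtains y where "0 < y" "0 < distr_fun M u y"
proof -
  have "\<exists>y>0. 0 < distr_fun M u y"
  proof (rule ccontr)
    assume "\<not> (\<exists>y>0. 0 < distr_fun M u y)"
    then have "emeasure M {x \<in> space M. ennreal (1 / Suc n) < u x} = 0" for n
      by (auto simp: distr_fun_def)
    then have "AE x in M. \<not> ennreal (1 / Suc n) < u x" for n
      by (intro AE_I[where N = "{x \<in> space M. ennreal (1 / Suc n) < u x}"]) auto
    then have "AE x in M. \<forall>n. \<not> ennreal (1 / Suc n) < u x"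
      unfolding AE_all_countable by blast
    then have "AE x in M. u x = 0"
    proof eventually_elim
      case (elim x)
      show ?case
      proof (rule ccontr)
        assume "u x \<noteq> 0"
        then obtain z where z: "0 < z" "z < u x" using dense[of 0 "u x"] by (auto simp: zero_less_iff_neq_zero)
        then obtain r where r: "z = ennreal r" "0 < r" by (cases z) (auto simp: ennreal_zero_less_top)
        then obtain n where "inverse (real (Suc n)) < r" using reals_Archimedean by blast
        then have "ennreal (1 / Suc n) \<le> z" unfolding r by (intro ennreal_leI) (auto simp: field_simps)
        then show False using z elim[rule_format, of n] by auto
      qed
    qed
    then show False using assms(2) by contradiction
  qed
  then show ?thesis using that by blast
qed

section \<open>Homogeneity, subadditivity, monotonicity and the Fatou property\<close>

context lorentz_karamata
begin

text \<open>This is \<open>LK_norm\<close> with the real parameter \<open>r\<close> in place of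
  \<open>recip p\<close>.\<close>

definition lk :: "real \<Rightarrow> ('a \<Rightarrow> ecomplex) \<Rightarrow> ennreal" where
  "lk r f = Lq_norm q (\<lambda>t. weight r t * max_rearr M f t)"

lemma max_rearr_measurable:
  assumes "(\<lambda>x. ecmod (f x)) \<in> borel_measurable M"
  shows "max_rearr M f \<in> borel_measurable halfline"
proof -
  have [measurable]: "K_fun M (\<lambda>x. ecmod (f x)) \<in> borel_measurable borel"
    using sigma_finite_measure_axioms assms by (rule K_fun_borel_measurable)
  have "(\<lambda>t. K_fun M (\<lambda>x. ecmod (f x)) t / ennreal t) \<in> borel_measurable halfline"
    by (rule borel_measurable_halfline) measurable
  then show ?thesis
    unfolding max_rearr_eq[OF sigma_finite_measure_axioms assms, symmetric] .
qed

lemma max_rearr_emb: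
  "f \<in> borel_measurable M \<Longrightarrow> max_rearr M (emb f) t = K_fun M f t / ennreal t"
  by (subst max_rearr_eq[OF sigma_finite_measure_axioms]) auto

lemma max_rearr_emb_measurable [measurable]:
  "f \<in> borel_measurable M \<Longrightarrow> max_rearr M (emb f) \<in> borel_measurable halfline"
  by (rule max_rearr_measurable) simp

lemma lk_cmult:
  assumes f: "f \<in> borel_measurable M" and a: "0 \<le> a"
  shows "lk r (emb (\<lambda>x. ennreal a * f x)) = ennreal a * lk r (emb f)"
proof -
  note [measurable] = f
  have "weight r t * max_rearr M (emb (\<lambda>x. ennreal a * f x)) t = ennreal a * (weight r t * max_rearr M (emb f) t)" for t
    using f K_fun_cmult[OF sigma_finite_measure_axioms f a, of t]
    by (simp add: max_rearr_emb divide_ennreal_def ac_simps)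
  then show ?thesis
    unfolding lk_def using a by (simp add: Lq_norm_cmult[OF q])
qed

lemma lk_add_le:
  assumes f: "f \<in> borel_measurable M" and g: "g \<in> borel_measurable M"
  shows "lk r (emb (\<lambda>x. f x + g x)) \<le> lk r (emb f) + lk r (emb g)"
proof -
  note [measurable] = f g
  have "lk r (emb (\<lambda>x. f x + g x)) \<le> Lq_norm q (\<lambda>t. weight r t * max_rearr M (emb f) t + weight r t * max_rearr M (emb g) t)"
    unfolding lk_def
  proof (intro Lq_norm_mono_AE q AE_I2)
    fix t assume "t \<in> space halfline"
    then have "K_fun M (\<lambda>x. f x + g x) t / ennreal t \<le> (K_fun M f t + K_fun M g t) / ennreal t"
      by (intro divide_right_mono_ennreal K_fun_add_le sigma_finite_measure_axioms f g) simp
    then show "weight r t * max_rearr M (emb (\<lambda>x. f x + g x)) t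
        \<le> weight r t * max_rearr M (emb f) t + weight r t * max_rearr M (emb g) t"
      unfolding distrib_left[symmetric]
      by (intro mult_left_mono) (simp_all add: max_rearr_emb add_divide_distrib_ennreal)
  qed measurable
  also have "\<dots> \<le> lk r (emb f) + lk r (emb g)"
    unfolding lk_def by (intro Lq_norm_add_le q) measurable
  finally show ?thesis .
qed

lemma lk_mono_AE:
  assumes f: "f \<in> borel_measurable M" and g: "g \<in> borel_measurable M" and ae: "AE x in M. f x \<le> g x"
  shows "lk r (emb f) \<le> lk r (emb g)"
proof -
  note [measurable] = f g
  show ?thesis
    unfolding lk_def
  proof (intro Lq_norm_mono_AE q AE_I2 mult_left_mono)
    show "max_rearr M (emb f) t \<le> max_rearr M (emb g) t" for t
      using f g by (simp add: max_rearr_emb divide_right_mono_ennreal K_fun_mono_AE ae)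
  qed measurable
qed

lemma lk_SUP:
  assumes F: "\<And>n::nat. F n \<in> borel_measurable M" and f: "f \<in> borel_measurable M"
    and ae: "AE x in M. incseq (\<lambda>n. F n x) \<and> f x = (SUP n. F n x)"
  shows "incseq (\<lambda>n. lk r (emb (F n)))" "lk r (emb f) = (SUP n. lk r (emb (F n)))"
proof -
  note [measurable] = F f
  have le: "AE x in M. F m x \<le> F n x" if "m \<le> n" for m n
    using ae by eventually_elim (use that in \<open>auto simp: incseq_def\<close>)
  then show "incseq (\<lambda>n. lk r (emb (F n)))"
    by (auto simp: incseq_def intro!: lk_mono_AE F)
  have "weight r t * max_rearr M (emb f) t = (SUP n. weight r t * max_rearr M (emb (F n)) t)" for t
    using F f K_fun_SUP[OF sigma_finite_measure_axioms F f ae, of t]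
    by (simp add: max_rearr_emb SUP_divide_ennreal SUP_mult_left_ennreal)
  then show "lk r (emb f) = (SUP n. lk r (emb (F n)))"
    unfolding lk_def
  proof (simp only:, intro Lq_norm_SUP q)
    show "incseq (\<lambda>n. weight r t * max_rearr M (emb (F n)) t)" for t
      using F by (auto simp: incseq_def max_rearr_emb intro!: mult_left_mono divide_right_mono_ennreal K_fun_mono_AE le)
  qed measurable
qed

section \<open>Lower bounds for non-zero functions\<close>

text \<open>Some level \<open>y\<close> has a superlevel set of positive measure;
  \<open>K_fun_ge\<close> at that level yields both bounds.\<close>

lemma max_rearr_ge:
  assumes u: "(\<lambda>x. ecmod (f x)) \<in> borel_measurable M" and nz: "\<not> (AE x in M. ecmod (f x) = 0)"
  obtains c where "0 < c" "\<And>t. 0 < t \<Longrightarrow> t < 1 \<Longrightarrow> ennreal c \<le> max_rearr M f t"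
    "\<And>t. 1 < t \<Longrightarrow> ennreal c * ennreal (1 / t) \<le> max_rearr M f t"
proof -
  obtain y where y: "0 < y" "0 < distr_fun M (\<lambda>x. ecmod (f x)) y"
    using distr_fun_pos_exists[OF u nz] .
  \<comment> \<open>Capping at 1 makes \<open>d\<close> finite and lets the one constant
    \<open>y * d\<close> serve on both sides of \<open>t = 1\<close>.\<close>
  obtain d where d: "0 < d" "d \<le> 1" "ennreal d \<le> distr_fun M (\<lambda>x. ecmod (f x)) y"
  proof (cases "distr_fun M (\<lambda>x. ecmod (f x)) y")
    case (real s)
    then show ?thesis using y that[of "min s 1"] by (auto simp: min_def split: if_splits)
  next
    case top
    then show ?thesis using that[of 1] by simp
  qed
  have *: "ennreal (y * min t d) / ennreal t \<le> max_rearr M f t" if "0 < t" for t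
  proof -
    have "ennreal (y * min t d) = ennreal y * min (ennreal t) (ennreal d)"
      using y d that by (simp add: ennreal_mult min_ennreal)
    also have "\<dots> \<le> ennreal y * min (ennreal t) (distr_fun M (\<lambda>x. ecmod (f x)) y)"
      using d by (intro mult_left_mono min.mono) auto
    also have "\<dots> \<le> K_fun M (\<lambda>x. ecmod (f x)) t" by (rule K_fun_ge[OF u y(1)])
    finally show ?thesis
      unfolding max_rearr_eq[OF sigma_finite_measure_axioms u] by (rule divide_right_mono_ennreal)
  qed
  show ?thesis
  proof (rule that)
    show "0 < y * d" using y d by simp
    fix t :: real
    { assume t: "0 < t" "t < 1"
      have "d * t \<le> t" "t * d \<le> d" using t d by (auto simp: mult_le_cancel_left1 mult_le_cancel_right1)
      then have "y * d \<le> y * min t d / t" using t y by (auto simp: field_simps min_def)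
      then have "ennreal (y * d) \<le> ennreal (y * min t d) / ennreal t"
        using t d y by (simp add: divide_ennreal ennreal_leI)
      then show "ennreal (y * d) \<le> max_rearr M f t" using *[OF t(1)] by (rule order_trans) }
    { assume t: "1 < t"
      then show "ennreal (y * d) * ennreal (1 / t) \<le> max_rearr M f t"
        using *[of t] d y by (simp add: divide_ennreal ennreal_mult[symmetric]) }
  qed
qed

lemma lk_ge_head_tail:
  assumes u: "(\<lambda>x. ecmod (f x)) \<in> borel_measurable M" and nz: "\<not> (AE x in M. ecmod (f x) = 0)"
  obtains c where "0 < c" "ennreal c * head_norm r \<le> lk r f" "ennreal c * tail_norm (r - 1) \<le> lk r f"
proof -
  obtain c where c: "0 < c" "\<And>t. 0 < t \<Longrightarrow> t < 1 \<Longrightarrow> ennreal c \<le> max_rearr M f t"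
    "\<And>t. 1 < t \<Longrightarrow> ennreal c * ennreal (1 / t) \<le> max_rearr M f t"
    using max_rearr_ge[OF u nz] by blast
  show ?thesis
  proof (rule that)
    show "0 < c" by fact
    have "ennreal c * head_norm r = Lq_norm q (\<lambda>t. ennreal c * (weight r t * indicator {0<..<1} t))"
      unfolding head_norm_def using c by (intro Lq_norm_cmult[symmetric] q) auto
    also have "\<dots> \<le> lk r f"
      unfolding lk_def
    proof (intro Lq_norm_mono_AE q AE_I2)
      fix t
      show "ennreal c * (weight r t * indicator {0<..<1} t) \<le> weight r t * max_rearr M f t"
        using c(2)[of t] mult_left_mono[of "ennreal c" "max_rearr M f t" "weight r t"]
        by (auto simp: indicator_def ac_simps)
    qed measurable
    finally show "ennreal c * head_norm r \<le> lk r f" .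
    have "ennreal c * tail_norm (r - 1) = Lq_norm q (\<lambda>t. ennreal c * (weight (r - 1) t * indicator {1<..} t))"
      unfolding tail_norm_def using c by (intro Lq_norm_cmult[symmetric] q) auto
    also have "\<dots> \<le> lk r f"
      unfolding lk_def
    proof (intro Lq_norm_mono_AE q AE_I2)
      fix t
      show "ennreal c * (weight (r - 1) t * indicator {1<..} t) \<le> weight r t * max_rearr M f t"
        using c(3)[of t] mult_left_mono[of "ennreal c * ennreal (1 / t)" "max_rearr M f t" "weight r t"]
        by (auto simp: indicator_def weight_diff_one ac_simps)
    qed measurable
    finally show "ennreal c * tail_norm (r - 1) \<le> lk r f" .
  qed
qed

text \<open>A vanishing norm forces the maximal function to vanish somewhere in
  \<open>(0,1)\<close>, as the weight is positive; \<open>max_rearr_ge\<close> excludes this for a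
  non-zero function.\<close>

lemma lk_eq_0_iff:
  assumes u: "(\<lambda>x. ecmod (f x)) \<in> borel_measurable M"
  shows "lk r f = 0 \<longleftrightarrow> (AE x in M. ecmod (f x) = 0)"
proof
  note [measurable] = max_rearr_measurable[OF u]
  assume "lk r f = 0"
  then have "AE t in halfline. weight r t * max_rearr M f t = 0"
    unfolding lk_def by (subst (asm) Lq_norm_eq_0_iff[OF q]) auto
  then obtain t where t: "0 < t" "t < 1" "weight r t * max_rearr M f t = 0"
    using AE_halfline_not_null[of _ 1] by auto
  then have "max_rearr M f t = 0" using weight_pos[of t r] by auto
  then show "AE x in M. ecmod (f x) = 0"
    using max_rearr_ge[OF u] t by (metis ennreal_eq_zero_iff le_zero_eq less_le_not_le)
next
  assume "AE x in M. ecmod (f x) = 0"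
  then have "K_fun M (\<lambda>x. ecmod (f x)) t \<le> K_fun M (\<lambda>x. 0) t" for t
    by (intro K_fun_mono_AE) auto
  then have "max_rearr M f t = 0" for t
    unfolding max_rearr_eq[OF sigma_finite_measure_axioms u] by (simp add: K_fun_def distr_fun_def)
  then show "lk r f = 0"
    unfolding lk_def by (simp add: Lq_norm_eq_0_iff[OF q])
qed

section \<open>Characteristic functions and local integrability\<close>

lemma lk_indicator_finite:
  assumes fin: "head_norm r < \<infinity>" "tail_norm (r - 1) < \<infinity>"
    and E[measurable]: "E \<in> sets M" and Efin: "emeasure M E < \<infinity>"
  shows "lk r (emb (indicator E)) < \<infinity>"
proof -
  obtain a where a: "emeasure M E = ennreal a" "0 \<le> a" using Efin by (cases "emeasure M E") auto
  let ?h = "\<lambda>t. weight r t * indicator {0<..<1} t" and ?k = "\<lambda>t. weight (r - 1) t * indicator {1<..} t"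
  \<comment> \<open>The maximal function is \<open>min t a / t\<close>, at most 1 and at most
    \<open>a / t\<close>; the constant \<open>1 + a\<close> covers both bounds.\<close>
  have "lk r (emb (indicator E)) \<le> Lq_norm q (\<lambda>t. ennreal (1 + a) * (?h t + ?k t))"
    unfolding lk_def
  proof (intro Lq_norm_mono_AE q)
    \<comment> \<open>The point 1 lies in neither of the two open sets on which the majorant
      lives.\<close>
    have "AE t in lebesgue. t \<noteq> (1::real)" by (intro AE_completion AE_lborel_singleton)
    then show "AE t in halfline. weight r t * max_rearr M (emb (indicator E)) t \<le> ennreal (1 + a) * (?h t + ?k t)"
      unfolding AE_halfline_iff
    proof eventually_elim
      case (elim t)
      have m: "max_rearr M (emb (indicator E)) t = ennreal (min t a / t)" if "0 < t"
        using that a by (simp add: max_rearr_emb K_fun_indicator min_ennreal divide_ennreal)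
      show ?case
      proof
        assume t: "0 < t"
        show "weight r t * max_rearr M (emb (indicator E)) t \<le> ennreal (1 + a) * (?h t + ?k t)"
        proof (cases "t < 1")
          case True
          have "min t a / t \<le> 1" using t by (simp add: divide_le_eq)
          then have "ennreal (min t a / t) \<le> ennreal (1 + a)" using a by (intro ennreal_leI) linarith
          then have "weight r t * ennreal (min t a / t) \<le> weight r t * ennreal (1 + a)"
            by (rule mult_left_mono) simp
          then show ?thesis using t True by (simp add: m mult.commute del: ennreal_plus)
        next
          case False
          have "min t a / t \<le> 1 / t * (1 + a)"
            using t by (simp add: divide_right_mono)
          then have "ennreal (min t a / t) \<le> ennreal (1 / t) * ennreal (1 + a)"
            using t a by (subst ennreal_mult[symmetric]) (auto intro!: ennreal_leI simp del: ennreal_plus)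
          then have "weight r t * ennreal (min t a / t) \<le> weight r t * (ennreal (1 / t) * ennreal (1 + a))"
            by (rule mult_left_mono) simp
          also have "\<dots> = ennreal (1 + a) * weight (r - 1) t"
            unfolding weight_diff_one[OF t] by (simp only: ac_simps)
          finally show ?thesis using t False elim by (simp add: m del: ennreal_plus)
        qed
      qed
    qed
  qed measurable
  also have "\<dots> = ennreal (1 + a) * Lq_norm q (\<lambda>t. ?h t + ?k t)"
    using a by (intro Lq_norm_cmult q) auto
  also have "\<dots> \<le> ennreal (1 + a) * (head_norm r + tail_norm (r - 1))"
    unfolding head_norm_def tail_norm_def by (intro mult_left_mono Lq_norm_add_le q) auto
  also have "\<dots> < \<infinity>" using fin by (simp add: ennreal_mult_less_top)
  finally show ?thesis .
qed

text \<open>Serves for a factor that may be infinite, namely a value of the maximal function;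
  infinity is treated as the supremum of the natural numbers.\<close>

lemma Lq_norm_cmult_ge:
  assumes [measurable]: "f \<in> borel_measurable halfline"
  shows "c * Lq_norm q f \<le> Lq_norm q (\<lambda>t. c * f t)"
proof (cases c)
  case (real a)
  then show ?thesis by (simp add: Lq_norm_cmult[OF q])
next
  case top
  have "of_nat n * Lq_norm q f \<le> Lq_norm q (\<lambda>t. c * f t)" for n
  proof -
    have "of_nat n * Lq_norm q f = Lq_norm q (\<lambda>t. ennreal (real n) * f t)"
      by (simp add: Lq_norm_cmult[OF q] ennreal_of_nat_eq_real_of_nat)
    also have "\<dots> \<le> Lq_norm q (\<lambda>t. c * f t)"
      using top by (intro Lq_norm_mono_AE q AE_I2 mult_right_mono) auto
    finally show ?thesis .
  qed
  then have "(SUP n. of_nat n * Lq_norm q f) \<le> Lq_norm q (\<lambda>t. c * f t)" by (intro SUP_least)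
  then show ?thesis
    unfolding top by (simp add: SUP_mult_right_ennreal[symmetric] ennreal_SUP_of_nat_eq_top)
qed

text \<open>The integral over \<open>E\<close> is at most \<open>a\<close> times the maximal
  function at \<open>a\<close>. The latter is non-increasing, so the norm is at least its value at
  \<open>a\<close> times the positive norm of the weight on \<open>(0,a)\<close>.\<close>

lemma lk_locally_integrable:
  assumes E: "E \<in> sets M" and Efin: "emeasure M E < \<infinity>"
  shows "\<exists>C<\<infinity>. \<forall>f\<in>borel_measurable M. (\<integral>\<^sup>+ x \<in> E. f x \<partial>M) \<le> C * lk r (emb f)"
proof -
  obtain a where a: "emeasure M E = ennreal a" "0 \<le> a" using Efin by (cases "emeasure M E") auto
  show ?thesis
  proof (cases "a = 0")
    case True
    have "(\<integral>\<^sup>+ x \<in> E. f x \<partial>M) \<le> 0" if "f \<in> borel_measurable M" for f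
      using nn_integral_le_K_fun[OF sigma_finite_measure_axioms that E a(1)] True by (simp add: K_fun_def)
    then show ?thesis by (intro exI[of _ 0]) auto
  next
    case False
    with a have a0: "0 < a" by simp
    define L where "L = Lq_norm q (\<lambda>t. weight r t * indicator {0<..<a} t)"
    have "L \<noteq> 0"
    proof
      assume "L = 0"
      then have "AE t in halfline. weight r t * indicator {0<..<a} t = 0"
        unfolding L_def by (subst (asm) Lq_norm_eq_0_iff[OF q]) auto
      then obtain t where "0 < t" "t < a" "weight r t * indicator {0<..<a} t = 0"
        using AE_halfline_not_null[of _ a] a0 by blast
      then show False using weight_pos[of t r] by auto
    qed
    \<comment> \<open>The number \<open>L\<close> may be infinite; a finite positive lower bound
      keeps \<open>a / c\<close> meaningful.\<close>
    then obtain c where c: "0 < c" "ennreal c \<le> L"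
    proof (cases L)
      case (real l)
      then show ?thesis using \<open>L \<noteq> 0\<close> that[of l] by auto
    next
      case top
      then show ?thesis using that[of 1] by auto
    qed
    have "(\<integral>\<^sup>+ x \<in> E. f x \<partial>M) \<le> ennreal (a / c) * lk r (emb f)" if f[measurable]: "f \<in> borel_measurable M" for f
    proof -
      let ?m = "max_rearr M (emb f) a"
      have "(\<integral>\<^sup>+ x \<in> E. f x \<partial>M) \<le> K_fun M f a"
        by (rule nn_integral_le_K_fun[OF sigma_finite_measure_axioms f E a(1)])
      also have "\<dots> = ennreal a * ?m"
        using a0 f by (simp add: max_rearr_emb ennreal_times_divide mult.commute[of "ennreal a"] mult_divide_eq_ennreal)
      also have "ennreal a = ennreal (a / c) * ennreal c"
        using a0 c by (simp add: ennreal_mult[symmetric])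
      also have "\<dots> * ?m = ennreal (a / c) * (?m * ennreal c)"
        by (simp only: ac_simps)
      also have "\<dots> \<le> ennreal (a / c) * (?m * L)"
        using c by (intro mult_left_mono) auto
      also have "?m * L \<le> Lq_norm q (\<lambda>t. ?m * (weight r t * indicator {0<..<a} t))"
        unfolding L_def by (rule Lq_norm_cmult_ge) measurable
      also have "\<dots> \<le> lk r (emb f)"
        unfolding lk_def
      proof (intro Lq_norm_mono_AE q AE_I2)
        fix t
        have "?m \<le> max_rearr M (emb f) t" if "0 < t" "t < a"
          using that by (intro max_rearr_antimono sigma_finite_measure_axioms) auto
        then show "?m * (weight r t * indicator {0<..<a} t) \<le> weight r t * max_rearr M (emb f) t"
          using mult_left_mono[of ?m "max_rearr M (emb f) t" "weight r t"]
          by (auto simp: indicator_def ac_simps)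
      qed measurable
      finally show ?thesis by (simp add: mult_left_mono)
    qed
    then show ?thesis by (intro exI[of _ "ennreal (a / c)"]) auto
  qed
qed

section \<open>Characterization of the norm property\<close>

text \<open>Only the values of the rearrangement at positive arguments enter the functional. This
  gives both invariance under passing to the modulus and (P6).\<close>

lemma lk_cong_rearr:
  assumes "\<And>t. 0 < t \<Longrightarrow> rearr M f t = rearr M g t"
  shows "lk r f = lk r g"
proof -
  have "rearr M f s * indicator {0<..<t} s = rearr M g s * indicator {0<..<t} s" for s t
    using assms by (auto simp: indicator_def)
  then show ?thesis by (simp add: lk_def max_rearr_def)
qed

lemma ri_Banach_function_norm_lk:
  assumes fin: "head_norm r < \<infinity>" "tail_norm (r - 1) < \<infinity>"
  shows "ri_Banach_function_norm M (lk r)"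
  unfolding ri_Banach_function_norm_def
proof (intro conjI ballI allI impI)
  show "lk r f = lk r (emb (\<lambda>x. ecmod (f x)))" for f
    by (rule lk_cong_rearr) (simp add: rearr_def)
  show "lk r (emb f) = 0 \<longleftrightarrow> (AE x in M. f x = 0)" if "f \<in> borel_measurable M" for f
    using lk_eq_0_iff[of "emb f" r] that by simp
  show "lk r (emb f) = lk r (emb g)" if "\<forall>t\<ge>0. rearr M (emb f) t = rearr M (emb g) t" for f g
    using that by (intro lk_cong_rearr) simp
  show "incseq (\<lambda>n. lk r (emb (F n)))" "lk r (emb f) = (SUP n. lk r (emb (F n)))"
    if "\<forall>n. F n \<in> borel_measurable M" "f \<in> borel_measurable M"
      "AE x in M. incseq (\<lambda>n. F n x) \<and> f x = (SUP n. F n x)" for F f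
    using lk_SUP[of F f r] that by blast+
qed (rule lk_cmult lk_add_le lk_mono_AE lk_indicator_finite[OF fin] lk_locally_integrable; assumption)+

text \<open>The functional dominates positive multiples of both weight norms, one of which is
  infinite here.\<close>

lemma lk_infinite:
  assumes "\<not> (head_norm r < \<infinity> \<and> tail_norm (r - 1) < \<infinity>)"
    and "(\<lambda>x. ecmod (f x)) \<in> borel_measurable M" and "\<not> (AE x in M. ecmod (f x) = 0)"
  shows "lk r f = \<infinity>"
proof -
  obtain c where "0 < c" "ennreal c * head_norm r \<le> lk r f" "ennreal c * tail_norm (r - 1) \<le> lk r f"
    using lk_ge_head_tail[OF assms(2,3)] by blast
  moreover have "head_norm r = top \<or> tail_norm (r - 1) = top"
    using assms(1) by (auto simp: not_less top_unique)
  ultimately show ?thesis by (auto simp: ennreal_mult_top top_unique)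
qed

text \<open>Necessity comes from (P4) for one set of positive finite measure: by
  \<open>lk_infinite\<close> its characteristic function would otherwise have infinite norm.\<close>

lemma ri_Banach_function_norm_lk_iff:
  assumes inf: "emeasure M (space M) = \<infinity>"
  shows "ri_Banach_function_norm M (lk r) \<longleftrightarrow> head_norm r < \<infinity> \<and> tail_norm (r - 1) < \<infinity>"
proof
  assume N: "ri_Banach_function_norm M (lk r)"
  \<comment> \<open>In a sigma-finite space of infinite measure, sets of finite measure exceed any
    given bound; the bound 1 secures positivity.\<close>
  obtain E where E: "E \<in> sets M" "0 < emeasure M E" "emeasure M E < \<infinity>"
    using approx_PInf_emeasure_with_finite[of "space M" 1] inf by (metis ennreal_1 infinity_ennreal_def less_trans sets.top zero_less_one)
  then have "lk r (emb (indicator E)) < \<infinity>"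
    using N unfolding ri_Banach_function_norm_def by blast
  moreover have "\<not> (AE x in M. ecmod (emb (indicator E) x) = 0)"
    using E by (simp add: indicator_eq_0_iff AE_iff_null_sets[symmetric] null_sets_def)
  ultimately show "head_norm r < \<infinity> \<and> tail_norm (r - 1) < \<infinity>"
    using lk_infinite[of r "emb (indicator E)"] E by auto
qed (blast intro: ri_Banach_function_norm_lk)

text \<open>For finite \<open>p\<close> the head is finite, and the sign of 1/p - 1 decides the
  tail, except at \<open>p = 1\<close>. For \<open>p = \<infinity>\<close> the tail exponent is -1,
  so only the head at 0 is left open.\<close>

lemma head_tail_finite_iff:
  assumes "0 < p"
  shows "head_norm (recip p) < \<infinity> \<and> tail_norm (recip p - 1) < \<infinity> \<longleftrightarrow>
    (1 < p \<and> p < \<infinity>) \<or> (p = 1 \<and> tail_norm 0 < \<infinity>) \<or> (p = \<infinity> \<and> head_norm 0 < \<infinity>)"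
proof (cases p)
  case (real s)
  with assms have s: "0 < s" by simp
  have r: "recip p = 1 / s"
    using real s divide_ennreal[of 1 s] by (simp add: recip_def)
  have h: "head_norm (recip p) < \<infinity>" using s r by (intro head_norm_finite) simp
  have p: "1 < p \<longleftrightarrow> 1 < s" "p = 1 \<longleftrightarrow> s = 1" "p < \<infinity>" "p \<noteq> \<infinity>"
    using real s ennreal_less_iff[of 1 s] by (auto simp: ennreal_eq_1)
  consider "s < 1" | "s = 1" | "1 < s" by linarith
  then show ?thesis
  proof cases
    case 1
    then have "tail_norm (recip p - 1) = \<infinity>" using 1 s by (intro tail_norm_infinite) (simp add: r)
    then show ?thesis using 1 p by simp
  next
    case 2
    then show ?thesis using h p r by simp
  next
    case 3
    then have "tail_norm (recip p - 1) < \<infinity>" using 3 s by (intro tail_norm_finite) (simp add: r)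
    then show ?thesis using 3 h p by simp
  qed
next
  case top
  then show ?thesis using tail_norm_finite[of "-1"] by simp
qed

end

lemma ecmod_eq_0_iff: "ecmod z = 0 \<longleftrightarrow> z = Some 0"
  by (auto simp: ecmod_def split: option.splits)

theorem proposition3p6:
  fixes M :: "'a measure" and p q :: ennreal and b :: "real \<Rightarrow> real"
  assumes "sigma_finite_measure M" and "non_atomic M" and "emeasure M (space M) = \<infinity>"
    and "0 < p" and "1 \<le> q" and "slowly_varying b"
  defines "cond \<equiv>
      (1 < p \<and> p < \<infinity>) \<or>
      (p = 1 \<and> Lq_norm q (\<lambda>t. ennreal (t powr (- recip q) * b t) * indicator {1<..} t) < \<infinity>) \<or>
      (p = \<infinity> \<and> Lq_norm q (\<lambda>t. ennreal (t powr (- recip q) * b t) * indicator {0<..<1} t) < \<infinity>)"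
  shows "(ri_Banach_function_norm M (LK_norm M p q b) \<longleftrightarrow> cond) \<and>
    (ri_Banach_function_norm M (LK_norm M p q b) \<longrightarrow>
       ri_Banach_function_space M (LK_space M p q b)) \<and>
    (\<not> cond \<longrightarrow> LK_space M p q b = {f \<in> meas_fun M. AE x in M. f x = Some 0})"
proof -
  interpret lorentz_karamata M q b
    by (intro lorentz_karamata.intro lorentz_karamata_axioms.intro assms)
  have lk: "LK_norm M p q b = lk (recip p)"
    by (rule ext) (simp add: LK_norm_def lk_def weight_def)
  have cond: "cond \<longleftrightarrow> head_norm (recip p) < \<infinity> \<and> tail_norm (recip p - 1) < \<infinity>"
    unfolding head_tail_finite_iff[OF \<open>0 < p\<close>]
    by (simp add: cond_def tail_norm_def head_norm_def weight_def)
  \<comment> \<open>When the condition fails, non-zero functions have infinite norm, while functions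
    vanishing almost everywhere have norm 0.\<close>
  have "lk (recip p) f < \<infinity> \<longleftrightarrow> (AE x in M. f x = Some 0)" if "\<not> cond" "f \<in> meas_fun M" for f
    using lk_infinite[of "recip p" f] lk_eq_0_iff[of f "recip p"] borel_measurable_ecmod[OF that(2)] that(1)
    unfolding cond ecmod_eq_0_iff by fastforce
  then show ?thesis
    unfolding lk cond[symmetric] LK_space_def ri_Banach_function_space_def
    using ri_Banach_function_norm_lk_iff[OF assms(3), of "recip p"] cond by blast
qed

end
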